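(* Let $C\subseteq\mathbb{R}^n$ be a (nonempty) affine subspace and let $f:C\times C\to\mathbb{R}$ satisfy $f(x,x)=0$ for all $x\in C$ and assumptions (A1)–(A5) of the context, with constants $\gamma>0$ and $\eta>0$, where $\gamma>8\eta$. Assume that the solution set $S(C;f)$ is nonempty. Let $\theta\in[0,\tfrac12)$, $\beta\in(-\infty,0]$, $\rho\in[0,1)$, and let $\{\lambda_k\}_{k\ge1}$, $\{\rho_k\}_{k\ge1}$ be sequences of positive numbers, and put $$\alpha^k_{\max}=\frac{2-\rho_k}{\rho_k},\qquad \alpha^k_{\min}=\frac{2-4\eta\lambda_k-\rho_k}{\rho_k}.$$ Assume that there exists $\epsilon>0$ such that for every $k\ge1$: (C1) $\dfrac{1}{\gamma-8\eta}<\lambda_k<\epsilon\le\dfrac{1}{4\eta}$; (C2) $0<1-\rho\le\rho_k\le1+\rho$ with $0\le\rho\le1-4\eta\epsilon$; (C3) $\max\left\{\dfrac{2\theta}{\alpha^k_{\min}}-(1-\theta),\ \dfrac{\theta}{1+\alpha^k_{\max}}-\alpha^k_{\min}\dfrac{(\theta-1)^2}{(1+\theta)(1+\alpha^k_{\max})}\right\}<\beta\le0$; (C4) $\theta^2(1-\alpha^k_{\min})+\theta(1-2\beta+2\alpha^k_{\max}-2\alpha^k_{\min})-\beta(1-2\alpha^k_{\min})+\beta^2(1-\alpha^k_{\min})-\alpha^k_{\min}<0$. Let $\{x_k\}$ be a sequence generated by the algorithm RTIPPA-EP described in the context with these parameters. Then $\{x_k\}$ converges to a solution of the equilibrium problem,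 that is, to a point of $S(C;f)$.
   Context: Equilibrium problem (EP): find $\hat x\in C$ such that $f(\hat x,y)\ge0$ for all $y\in C$. Its solution set is denoted $S(C;f)$. Here $\|\cdot\|$ is the Euclidean norm on $\mathbb{R}^n$. A function $g:C\to\mathbb{R}$ on a convex set $C$ is strongly quasiconvex on $C$ with modulus $\gamma>0$ if $$g(\mu y+(1-\mu)x)\le\max\{g(y),g(x)\}-\mu(1-\mu)\frac{\gamma}{2}\|x-y\|^2\quad\text{for all }x,y\in C,\ \mu\in[0,1].$$ Assumptions on $f$: (A1) $f(\cdot,y)$ is upper semicontinuous on $C$ for every $y\in C$. (A2) $f$ is pseudomonotone on $C$: for all $x,y\in C$, $f(x,y)\ge0$ implies $f(y,x)\le0$. (A3) $f$ is lower semicontinuous jointly in both arguments. (A4) For each $x\in C$, $f(x,\cdot)$ is strongly quasiconvex on $C$ with modulus $\gamma>0$ (the same $\gamma$ for all $x$). (A5) There is $\eta>0$ such that $f(x,z)-f(x,y)-f(y,z)\le\eta\left(\|x-y\|^2+\|y-z\|^2\right)$ for all $x,y,z\in C$. Algorithm RTIPPA-EP (relaxed proximal point algorithm with double inertial steps): given starting points $x_{-1},x_0,x_1\in C$, for $k=1,2,3,\dots$ compute $$y_k=x_k+\theta(x_k-x_{k-1})+\beta(x_{k-1}-x_{k-2}),$$ $$z_k\in\operatorname*{argmin}_{x\in C}\left\{f(y_k,x)+\frac{1}{2\lambda_k}\|y_k-x\|^2\right\};$$ if $y_k=z_k$ stop; otherwise, with relaxation parameter $\rho_k\in[1-\rho,1+\rho]$,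 set $$x_{k+1}=(1-\rho_k)y_k+\rho_kz_k.$$ Here $z_k$ is any choice of a minimizer. Statements about the limiting behaviour of the generated sequences refer to infinite sequences, i.e. the case in which the stopping test is never met. *)

theory Defs
  imports "HOL-Analysis.Analysis"
begin

text \<open>Functions on a set are total functions here; only their values on that set are ever used.\<close>

definition lsc_on :: "'a::topological_space set \<Rightarrow> ('a \<Rightarrow> real) \<Rightarrow> bool" where
  "lsc_on S g \<longleftrightarrow> (\<forall>x\<in>S. \<forall>a. a < g x \<longrightarrow> (\<forall>\<^sub>F u in at x within S. a < g u))"

definition usc_on :: "'a::topological_space set \<Rightarrow> ('a \<Rightarrow> real) \<Rightarrow> bool" where
  "usc_on S g \<longleftrightarrow> (\<forall>x\<in>S. \<forall>a. g x < a \<longrightarrow> (\<forall>\<^sub>F u in at x within S. g u < a))"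

definition pseudomonotone_on :: "'a set \<Rightarrow> ('a \<Rightarrow> 'a \<Rightarrow> real) \<Rightarrow> bool" where
  "pseudomonotone_on C f \<longleftrightarrow> (\<forall>x\<in>C. \<forall>y\<in>C. f x y \<ge> 0 \<longrightarrow> f y x \<le> 0)"

definition strongly_quasiconvex_on ::
    "'a::real_normed_vector set \<Rightarrow> real \<Rightarrow> ('a \<Rightarrow> real) \<Rightarrow> bool" where
  "strongly_quasiconvex_on C \<gamma> g \<longleftrightarrow>
     convex C \<and> \<gamma> > 0 \<and>
     (\<forall>x\<in>C. \<forall>y\<in>C. \<forall>\<mu>\<in>{0..1}.
        g (\<mu> *\<^sub>R y + (1 - \<mu>) *\<^sub>R x)
          \<le> max (g y) (g x) - \<mu> * (1 - \<mu>) * (\<gamma> / 2) * (norm (x - y))\<^sup>2)"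

definition EP_solutions :: "'a set \<Rightarrow> ('a \<Rightarrow> 'a \<Rightarrow> real) \<Rightarrow> 'a set" where
  "EP_solutions C f = {x\<in>C. \<forall>y\<in>C. f x y \<ge> 0}"

text \<open>
  An infinite run of the relaxed proximal point algorithm with double inertial steps.
  The iterates \<open>x\<close> are indexed by integers because the starting points are
  \<open>x (-1)\<close>, \<open>x 0\<close> and \<open>x 1\<close>; values at indices below \<open>-1\<close>, and values of the other
  sequences at index \<open>0\<close>, are irrelevant. The conjunct \<open>y k \<noteq> z k\<close> says that the stopping
  test is never met.
\<close>

definition RTIPPA_EP ::
    "'a::real_normed_vector set \<Rightarrow> ('a \<Rightarrow> 'a \<Rightarrow> real) \<Rightarrow> real \<Rightarrow> real \<Rightarrow>
     (nat \<Rightarrow> real) \<Rightarrow> (nat \<Rightarrow> real) \<Rightarrow> (int \<Rightarrow> 'a) \<Rightarrow> (nat \<Rightarrow> 'a) \<Rightarrow> (nat \<Rightarrow> 'a) \<Rightarrow> bool" where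
  "RTIPPA_EP C f \<theta> \<beta> lam \<rho>s x y z \<longleftrightarrow>
     x (-1) \<in> C \<and> x 0 \<in> C \<and> x 1 \<in> C \<and>
     (\<forall>k\<ge>1.
        y k = x (int k) + \<theta> *\<^sub>R (x (int k) - x (int k - 1))
                + \<beta> *\<^sub>R (x (int k - 1) - x (int k - 2)) \<and>
        is_arg_min (\<lambda>u. f (y k) u + 1 / (2 * lam k) * (norm (y k - u))\<^sup>2) (\<lambda>u. u \<in> C) (z k) \<and>
        y k \<noteq> z k \<and>
        x (int k + 1) = (1 - \<rho>s k) *\<^sub>R y k + \<rho>s k *\<^sub>R z k)"

definition alpha_max :: "real \<Rightarrow> real" where
  "alpha_max r = (2 - r) / r"

definition alpha_min :: "real \<Rightarrow> real \<Rightarrow> real \<Rightarrow> real" where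
  "alpha_min \<eta> l r = (2 - 4 * \<eta> * l - r) / r"

end

(*
  Write t = theta and b = -beta, and let p be a solution. Strong quasiconvexity at the midpoint of
  p and z_k, combined with (A5), yields
    |x_{k+1} - p|^2 + alpha_min |x_{k+1} - y_k|^2 + 2 rho_k lambda_k eta |z_k - p|^2 <= |y_k - p|^2.
  By (C3), alpha_min is at least the constant a = (t + b)(1 + t) / ((1 - t)^2 - b(1 + t)), so a may
  replace it although alpha_min varies with k. For this a there is a nonnegative quadratic Lyapunov
  function of w = x_k - p, d = x_k - x_{k-1}, e = x_{k-1} - x_{k-2} whose increment is at most
  |x_{k+1} - p|^2 + a |x_{k+1} - y_k|^2 - |y_k - p|^2. Hence z_k tends to p; since
  2 - rho_k - a rho_k >= 4 eta lambda_k is bounded away from 0, the same increments then force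
  y_k to p, and with it x_k.
*)
theory Submission
  imports Defs
begin

subsection \<open>A Lyapunov function for double inertial steps\<close>

text \<open>The substitute is guided by the Kalman-Yakubovich-Popov principle: a quadratic function
  with the required increment bound should exist when \<open>|v|^2 + a |v - y|^2 - |y|^2\<close> is
  nonnegative along all oscillations \<open>x_k = zeta^k\<close> with |zeta| = 1. This expression
  vanishes at zeta = 1, since constant sequences cost nothing, and the factor
  \<open>|1 - zeta|^2\<close> can be split off. The obstacle is that dissipation does not make the
  function nonnegative. The free parameter \<open>s\<close> has to serve both purposes, and most of
  the work is the positivity of the resulting form. The constant \<open>a\<close> is the equality
  case of the second bound in (C3) after \<open>alpha_max\<close> is replaced by
  \<open>alpha_min\<close>; for b = 0 it is sharp, because the frequency quadratic then vanishes at
  x = 1. Any solution may serve as p, and the limit is p itself, so no cluster points have to be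
  identified.\<close>

lemma quad_form_nonneg:
  fixes u v :: "'a::real_inner"
  assumes "0 \<le> A" "0 \<le> B" "C\<^sup>2 \<le> A * B"
  shows "0 \<le> A * (norm u)\<^sup>2 + 2 * C * (u \<bullet> v) + B * (norm v)\<^sup>2"
proof -
  have "\<bar>C\<bar> \<le> sqrt A * sqrt B"
    using assms(3) by (metis real_sqrt_abs real_sqrt_le_iff real_sqrt_mult)
  then have "\<bar>C\<bar> * \<bar>u \<bullet> v\<bar> \<le> (sqrt A * sqrt B) * (norm u * norm v)"
    by (intro mult_mono Cauchy_Schwarz_ineq2) (use assms in auto)
  then have "- (sqrt A * sqrt B * (norm u * norm v)) \<le> C * (u \<bullet> v)"
    by (metis abs_le_D2 abs_mult minus_le_iff)
  moreover have "0 \<le> (sqrt A * norm u - sqrt B * norm v)\<^sup>2" by simp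
  ultimately show ?thesis
    using assms by (simp add: power2_diff power_mult_distrib algebra_simps)
qed

text \<open>As a quadratic in \<open>v\<close> this has discriminant
  \<open>(1 - b)^2 * (1 - 8 * b)\<close>, so only b < 1/8 needs \<open>v \<le> 1\<close>. There the
  vertex lies beyond 1, and the expansion is around v = 1.\<close>

lemma frequency_bound_aux:
  fixes b v :: real
  assumes "0 \<le> b" "b \<le> 1" "0 \<le> v" "v \<le> 1"
  shows "0 \<le> 2 * b * v\<^sup>2 + (1 - b) * (1 - b - v)"
proof (cases "b \<le> 1/8")
  case True
  have "2 * b * v\<^sup>2 + (1 - b) * (1 - b - v)
      = b + b\<^sup>2 + (1 - v) * (1 - 5 * b) + 2 * b * (1 - v)\<^sup>2"
    by (simp add: power2_eq_square algebra_simps)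
  also have "\<dots> \<ge> 0" using True assms by (intro add_nonneg_nonneg mult_nonneg_nonneg) auto
  finally show ?thesis .
next
  case False
  have "8 * b * (2 * b * v\<^sup>2 + (1 - b) * (1 - b - v))
      = (4 * b * v - (1 - b))\<^sup>2 + (1 - b)\<^sup>2 * (8 * b - 1)"
    by (simp add: power2_eq_square algebra_simps)
  also have "\<dots> \<ge> 0" using False by (intro add_nonneg_nonneg mult_nonneg_nonneg) auto
  finally show ?thesis using False by (simp add: zero_le_mult_iff)
qed

text \<open>
  With \<open>x = cos \<omega>\<close>, the quadratic below is the frequency-domain form of the dissipation inequality:
  \<open>1 + a * \<bar>\<zeta> - q\<bar>\<^sup>2 - \<bar>q\<bar>\<^sup>2\<close> divided by \<open>\<bar>1 - \<zeta>\<bar>\<^sup>2\<close>, where \<open>\<zeta> = exp (\<i> * \<omega>)\<close> and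
  \<open>q = 1 + t - (t + b) / \<zeta> + b / \<zeta>\<^sup>2\<close>.
\<close>
lemma frequency_bound:
  fixes t b a x :: real
  defines "n \<equiv> (1 - t)\<^sup>2 - b * (1 + t)"
  assumes t: "0 \<le> t" "t < 1" and b: "0 \<le> b" and n: "0 < n"
    and a: "a * n = (t + b) * (1 + t)" and x: "-1 \<le> x" "x \<le> 1"
  shows "0 \<le> a * ((1 - b)\<^sup>2 + t\<^sup>2) - t * (1 + t) + b * (1 - b)
           + 2 * (b * (1 + t) - a * t * (1 + b)) * x + 4 * a * b * x\<^sup>2"  (is "0 \<le> ?g")
proof -
  have n1: "n \<le> 1 - b"
  proof -
    have "1 - b - n = t * (1 - t) + t + b * t" by (simp add: n_def power2_eq_square algebra_simps)
    then show ?thesis using t b by (smt (verit) mult_nonneg_nonneg)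
  qed
  then have b1: "b < 1" using n by linarith
  \<comment> \<open>Multiplying \<open>?g\<close> by \<open>n\<close> eliminates \<open>a\<close>
    through the equation for \<open>a * n\<close>; \<open>T\<close> is half of the resulting
    polynomial, grouped by the factors \<open>t + b\<close> and \<open>b * n\<close>.\<close>
  define c where "c = (1 + t) * (1 - x) - b * (1 + t) * x - b * (1 - t)"
  define T where "T = (t + b) * (t * c + 2 * b * (1 + t) * x\<^sup>2) + b * n * (1 + x + t * x - b)"
  have h: "n * ?g = (a * n) * ((1 - b)\<^sup>2 + t\<^sup>2 - 2 * t * (1 + b) * x + 4 * b * x\<^sup>2)
         + n * (b * (1 - b) - t * (1 + t) + 2 * b * (1 + t) * x)"
    by (simp add: algebra_simps)
  have "n * ?g = 2 * T"
    unfolding h a unfolding T_def c_def n_def by (simp add: power2_eq_square algebra_simps)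
  moreover have "0 \<le> T"
  proof (cases "0 \<le> x")
    case True
    have "0 \<le> (1 + x + t * x - b)" using True t b1 by (smt (verit) mult_nonneg_nonneg)
    then have 1: "0 \<le> b * n * (1 + x + t * x - b)" using b n by auto
    have eq: "t * c + 2 * b * (1 + t) * x\<^sup>2 = t * (1 - b) * (1 - x)
        + t\<^sup>2 * (1 - x) * (1 - b) + t\<^sup>2 * b * (1 - x)
        + b * (t\<^sup>2 * (1 - x) + 2 * x\<^sup>2 + 2 * t * x\<^sup>2 - 2 * t * x)"
      unfolding c_def by (simp add: power2_eq_square algebra_simps)
    have "2 * (t\<^sup>2 * (1 - x) + 2 * x\<^sup>2 + 2 * t * x\<^sup>2 - 2 * t * x)
        = (t - 2 * x)\<^sup>2 + t * (t + 4 * x\<^sup>2 - 2 * t * x)"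
      by (simp add: power2_eq_square algebra_simps)
    moreover have "0 \<le> t + 4 * x\<^sup>2 - 2 * t * x"
    proof -
      have "t * x \<le> 1 * x" using True t by (intro mult_right_mono) auto
      moreover have "t * (t * t) \<le> t * 1" using t by (intro mult_left_mono) (auto simp: mult_le_one)
      moreover have "0 \<le> (2 * x - t / 2)\<^sup>2" by simp
      ultimately show ?thesis using t mult_left_le[of t t]
        by (simp add: power2_eq_square algebra_simps)
    qed
    ultimately have 2: "0 \<le> t\<^sup>2 * (1 - x) + 2 * x\<^sup>2 + 2 * t * x\<^sup>2 - 2 * t * x"
      using t by (smt (verit) mult_nonneg_nonneg zero_le_power2)
    have "0 \<le> t * c + 2 * b * (1 + t) * x\<^sup>2"
      unfolding eq using 2 t b b1 x by (intro add_nonneg_nonneg mult_nonneg_nonneg) auto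
    then show ?thesis unfolding T_def using 1 t b by auto
  next
    case False
    define v where "v = - x"
    have v: "0 \<le> v" "v \<le> 1" using False x by (auto simp: v_def)
    have c: "c = (1 - b) + v + t * (1 + v) + b * v * (1 + t) + b * t"
      unfolding c_def v_def by (simp add: algebra_simps)
    have cv: "v \<le> c" unfolding c using v t b b1
      by (smt (verit) mult_nonneg_nonneg)
    have L: "0 \<le> 2 * b * v\<^sup>2 + (1 - b) * (1 - b - v)"
      using frequency_bound_aux b b1 v by auto
    \<comment> \<open>When \<open>1 - b - v\<close> is negative the expression decreases in
      \<open>n\<close>, so the worst case is n = 1 - b, which is \<open>L\<close>.\<close>
    have M: "0 \<le> 2 * b * v\<^sup>2 + n * (1 - b - v)"
    proof (cases "1 - b - v \<ge> 0")
      case True then show ?thesis using b n by auto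
    next
      case False
      then have "(1 - b) * (1 - b - v) \<le> n * (1 - b - v)"
        using n1 by (intro mult_right_mono_neg) auto
      then show ?thesis using L by linarith
    qed
    have N: "0 \<le> t * (c - n * v)"
    proof -
      have "n * v \<le> 1 * v" using n1 b v by (intro mult_right_mono) auto
      then show ?thesis using cv t by auto
    qed
    have T: "T = t * t * c + t * 2 * b * (1 + t) * v\<^sup>2 + b * (t * (c - n * v))
            + 2 * b * b * t * v\<^sup>2 + b * (2 * b * v\<^sup>2 + n * (1 - b - v))"
      unfolding T_def v_def by (simp add: power2_eq_square algebra_simps)
    have "0 \<le> c" using cv v by linarith
    then show ?thesis unfolding T using M N t b v
      by (intro add_nonneg_nonneg mult_nonneg_nonneg[OF b M] mult_nonneg_nonneg[OF b N]) auto
  qed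
  ultimately show ?thesis using n by (smt (verit) mult_pos_neg)
qed

text \<open>
  The coefficients \<open>e11\<close>, \<open>e12\<close>, \<open>e22\<close> weigh \<open>d \<bullet> d\<close>, \<open>2 * (d \<bullet> e)\<close>, \<open>e \<bullet> e\<close> in the Lyapunov function. They
  are chosen so that, with \<open>u = x\<^bsub>k+1\<^esub> - x\<^bsub>k\<^esub>\<close>, the dissipation inequality leaves the remainder
  \<open>a * b * \<bar>u + s * d + e\<bar>\<^sup>2 + \<bar>\<kappa> - 2 * a * b * s\<bar> * \<bar>u \<plusminus> d\<bar>\<^sup>2\<close> plus a multiple of \<open>\<bar>d\<bar>\<^sup>2\<close>.
  The last three conclusions say that the Schur complement of the Lyapunov form with respect to \<open>w\<close>,
  multiplied by \<open>D\<close>, is positive semidefinite. The value \<open>- s / 2\<close> is the minimizer on \<open>[-1, 1]\<close> of the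
  quadratic in \<open>frequency_bound\<close>, whence the three cases.
\<close>
lemma lyapunov_parameter:
  fixes t b a :: real
  defines "n \<equiv> (1 - t)\<^sup>2 - b * (1 + t)"
    and "D \<equiv> 1 - t + b"
    and "\<kappa> \<equiv> b * (1 + t) - a * t * (1 + b)"
    and "e22 \<equiv> b * (1 - b) * (a - 1)"
  assumes t: "0 \<le> t" "t < 1/2" and b: "0 \<le> b" and n: "0 < n"
    and a: "a * n = (t + b) * (1 + t)"
  obtains e11 e12 s where
    "e11 = a * (1 - b) - \<bar>\<kappa> - 2 * a * b * s\<bar>"
    "e12 = a * b * s - b * (1 + t - a * t)"
    "0 \<le> a * ((1 - b)\<^sup>2 + t\<^sup>2) - t * (1 + t) + b * (1 - b)
           - a * b * s\<^sup>2 - 2 * \<bar>\<kappa> - 2 * a * b * s\<bar>"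
    "0 \<le> D * e11 - (t - b)" "0 \<le> D * e22 + b * (1 - t)"
    "(D * e12 + b)\<^sup>2 \<le> (D * e11 - (t - b)) * (D * e22 + b * (1 - t))"
proof -
  define \<delta> where "\<delta> = t - b"
  \<comment> \<open>In the scaled Schur complement \<open>a\<close> occurs only with the factor
    \<open>D\<close>, so lower bounds on \<open>B\<close> are all that is needed about
    \<open>a\<close>.\<close>
  define B where "B = a * D"
  have a0: "0 \<le> a"
  proof -
    have "0 \<le> a * n" using a t b by auto
    then show ?thesis using n by (simp add: zero_le_mult_iff)
  qed
  have tb0: "0 \<le> t * b" using t b by simp
  have D0: "0 < D" using t b by (simp add: D_def)
  have n1: "n \<le> 1 - b"
  proof -
    have "1 - b - n = t * (1 - t) + t + b * t" by (simp add: n_def power2_eq_square algebra_simps)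
    moreover have "0 \<le> t * (1 - t)" "0 \<le> b * t" using t b by auto
    ultimately show ?thesis using t by linarith
  qed
  then have b1: "b < 1" using n by linarith
  have B0: "0 \<le> B" using a0 D0 by (simp add: B_def)
  have Bn: "B * n = (t + b) * (1 + t) * D" using a by (simp add: B_def algebra_simps)
  have F: "t \<le> 1 - b - t * b"
  proof -
    have "1 - b - t * b - t = n + t * (1 - t)" by (simp add: n_def power2_eq_square algebra_simps)
    moreover have "0 \<le> t * (1 - t)" using t by auto
    ultimately show ?thesis using n by linarith
  qed
  \<comment> \<open>The basic lower bound on \<open>B\<close>: it comes from comparing
    \<open>n\<close> with a multiple of \<open>D\<close> in \<open>Bn\<close>.\<close>
  have core: "(t + b) * (1 + t) \<le> B * (1 - b - t - t * b)"
  proof -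
    have "D * (1 - b - t - t * b) - n = b * (t\<^sup>2 + (1 - b - t * b))"
      by (simp add: n_def D_def power2_eq_square algebra_simps)
    also have "\<dots> \<ge> 0" using b F t by auto
    finally have "n \<le> D * (1 - b - t - t * b)" by simp
    then have "(t + b) * (1 + t) * n \<le> (t + b) * (1 + t) * (D * (1 - b - t - t * b))"
      using t b by (intro mult_left_mono) auto
    also have "\<dots> = (B * n) * (1 - b - t - t * b)" unfolding Bn by (simp add: ac_simps)
    also have "\<dots> = B * (1 - b - t - t * b) * n" by simp
    finally show ?thesis using n by simp
  qed
  have BL: "(t + b) * (1 + t) \<le> B"
  proof -
    have "B * (1 - b - t - t * b) \<le> B * 1"
      using t b B0 mult_nonneg_nonneg[of t b] by (intro mult_left_mono) linarith+
    then show ?thesis using core by linarith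
  qed
  have tbL: "t + b \<le> (t + b) * (1 + t)" "\<delta> \<le> (t + b) * (1 + t)"
    using t b mult_nonneg_nonneg[of t b] by (auto simp: \<delta>_def algebra_simps intro: add_nonneg_nonneg)
  then have B\<delta>: "\<delta> \<le> B" using BL by linarith
  have P22: "D * e22 + b * (1 - t) = b * (B * (1 - b) - b * \<delta>)"
    by (simp add: e22_def D_def B_def \<delta>_def algebra_simps)
  have P22': "0 \<le> B * (1 - b) - b * \<delta>"
  proof (cases "0 \<le> \<delta>")
    case True
    have "B * (1 - b - t - t * b) \<le> B * (1 - b)"
      using t b B0 tb0 by (intro mult_left_mono) linarith+
    moreover have "b * \<delta> \<le> 1 * \<delta>" using True b1 by (intro mult_right_mono) auto
    ultimately show ?thesis using core tbL by linarith
  next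
    case False
    then have "b * \<delta> \<le> 0" using b by (simp add: mult_le_0_iff)
    moreover have "0 \<le> B * (1 - b)" using B0 b1 by auto
    ultimately show ?thesis by linarith
  qed
  define p11 where "p11 s = D * (a * (1 - b) - \<bar>\<kappa> - 2 * a * b * s\<bar>) - (t - b)" for s
  define p12 where "p12 s = D * (a * b * s - b * (1 + t - a * t)) + b" for s
  define c0 where "c0 = a * ((1 - b)\<^sup>2 + t\<^sup>2) - t * (1 + t) + b * (1 - b)"
  have freq: "0 \<le> c0 + 2 * \<kappa> * x + 4 * a * b * x\<^sup>2" if "-1 \<le> x" "x \<le> 1" for x
    using frequency_bound[of t b a x] t b n a that by (auto simp: c0_def \<kappa>_def n_def)
  \<comment> \<open>The factor \<open>1 + b\<close> turns the term \<open>a * t\<close> of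
    \<open>p12\<close> into \<open>a * t * (1 + b)\<close>, which can be compared with
    \<open>\<kappa>\<close>. It is cancelled at the end.\<close>
  have main: "\<exists>s. 0 \<le> c0 - a * b * s\<^sup>2 - 2 * \<bar>\<kappa> - 2 * a * b * s\<bar> \<and> 0 \<le> p11 s \<and>
      ((1 + b) * p12 s)\<^sup>2 \<le> (1 + b)\<^sup>2 * (p11 s * (b * (B * (1 - b) - b * \<delta>)))"
  proof -
    \<comment> \<open>\<open>s\<close> is the zero of \<open>\<kappa> - 2 * a * b * s\<close>,
      clipped to [-2, 2]. With this choice the first conjunct is \<open>freq\<close> at
      \<open>x = - s/2\<close>.\<close>
    consider (I) "\<bar>\<kappa>\<bar> < 4 * a * b" | (II) "\<kappa> + 4 * a * b \<le> 0" | (III) "4 * a * b \<le> \<kappa>"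
      by linarith
    then show ?thesis
    proof cases

      \<comment> \<open>Interior minimizer: the absolute value vanishes\<close>
      case I
      then have ab: "0 < a * b" using abs_ge_zero[of \<kappa>] by linarith
      define s where "s = \<kappa> / (2 * (a * b))"
      have s: "2 * a * b * s = \<kappa>" using ab by (auto simp: s_def)
      define A where "A = B * (1 - b)"
      have A0: "0 \<le> A" using B0 b1 by (simp add: A_def)
      have "0 \<le> c0 + 2 * \<kappa> * (- s/2) + 4 * a * b * (- s/2)\<^sup>2"
      proof (rule freq)
        have "\<kappa> < 2 * (2 * (a * b))" "- 2 * (2 * (a * b)) < \<kappa>" using I by linarith+
        then have "s < 2" "- 2 < s"
          unfolding s_def using ab pos_divide_less_eq[of "2 * (a * b)" \<kappa> 2]
            pos_less_divide_eq[of "2 * (a * b)" "- 2" \<kappa>] by linarith+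
        then show "-1 \<le> - s/2" "- s/2 \<le> 1" by linarith+
      qed
      then have 1: "0 \<le> c0 - a * b * s\<^sup>2 - 2 * \<bar>\<kappa> - 2 * a * b * s\<bar>"
      proof -
        have "\<kappa> * s = 2 * (a * b * s\<^sup>2)" unfolding s[symmetric] power2_eq_square by simp
        then have "2 * \<kappa> * (- s/2) = - (2 * (a * b * s\<^sup>2))" by simp
        moreover have "4 * a * b * (- s/2)\<^sup>2 = a * b * s\<^sup>2" by (simp add: power2_eq_square)
        ultimately have "0 \<le> c0 - a * b * s\<^sup>2" using \<open>0 \<le> c0 + _ + _\<close> by linarith
        then show ?thesis using s by simp
      qed
      have p11: "p11 s = A - \<delta>" using s by (simp add: p11_def A_def B_def \<delta>_def algebra_simps)
      have "B * (1 - b - t - t * b) \<le> A"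
        unfolding A_def using t b B0 tb0 by (intro mult_left_mono) linarith+
      then have 2: "0 \<le> p11 s" unfolding p11 using core tbL by linarith
      have p12s: "2 * p12 s = D * (2 * a * b * s) - 2 * D * (b * (1 + t - a * t)) + 2 * b"
        by (simp add: p12_def algebra_simps)
      have "(1 + b) * (2 * p12 s) = \<kappa> * D * (1 - b) + 2 * b * t * \<delta>"
        unfolding p12s s by (simp add: \<kappa>_def D_def \<delta>_def power2_eq_square algebra_simps)
      then have p12: "(1 + b) * p12 s = \<kappa> * (D * (1 - b)) / 2 + b * t * \<delta>" by (simp add: field_simps)
      have "\<bar>\<kappa> * (D * (1 - b))\<bar> \<le> 4 * a * b * (D * (1 - b))"
        using I D0 b1 by (simp add: abs_mult)
      also have "\<dots> = 4 * b * A" by (simp add: A_def B_def)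
      finally have q: "\<bar>\<kappa> * (D * (1 - b))\<bar> \<le> 4 * b * A" .
      have "\<bar>b * t * \<delta>\<bar> = b * t * \<bar>\<delta>\<bar>" using b t by (simp add: abs_mult)
      then have "\<bar>(1 + b) * p12 s\<bar> \<le> 2 * b * A + b * t * \<bar>\<delta>\<bar>"
        using q p12 by linarith
      then have "\<bar>(1 + b) * p12 s\<bar>\<^sup>2 \<le> (2 * b * A + b * t * \<bar>\<delta>\<bar>)\<^sup>2"
        by (rule power_mono) simp
      also have "\<dots> = b * (b * (2 * A + t * \<bar>\<delta>\<bar>)\<^sup>2)"
        by (simp add: power2_eq_square algebra_simps)
      finally have p12': "((1 + b) * p12 s)\<^sup>2 \<le> b * (b * (2 * A + t * \<bar>\<delta>\<bar>)\<^sup>2)" by simp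
      have b2t: "0 \<le> b * \<delta>\<^sup>2 * ((1 + b)\<^sup>2 - t\<^sup>2)"
        using t b by (intro mult_nonneg_nonneg) (auto intro: power_mono)
      \<comment> \<open>The difference is quadratic in \<open>A\<close> with leading coefficient
        \<open>(1 + b)^2 - 4 * b = (1 - b)^2\<close> and a nonnegative constant term. Only for
        \<open>\<delta>\<close> positive can the linear term hurt; it is then absorbed by the
        leading one, the two meeting at \<open>(t + b) * (1 + t)\<close>.\<close>
      have "b * (2 * A + t * \<bar>\<delta>\<bar>)\<^sup>2 \<le> (1 + b)\<^sup>2 * ((A - \<delta>) * (A - b * \<delta>))"
      proof (cases "0 \<le> \<delta>")
        case True
        then have bt: "b \<le> t" by (simp add: \<delta>_def)
        \<comment> \<open>Sharper than the estimate behind \<open>core\<close>, and valid because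
          \<open>b \<le> t\<close>; it yields a bound on \<open>B\<close> strong enough for the
          factor \<open>(1 - b)^3\<close>.\<close>
        have nD: "n \<le> D * (1 - t - 2 * b)"
        proof -
          have "D * (1 - t - 2 * b) - n = 2 * b * (t - b)"
            by (simp add: n_def D_def power2_eq_square algebra_simps)
          moreover have "0 \<le> 2 * b * (t - b)" using bt b by auto
          ultimately show ?thesis by linarith
        qed
        then have pos: "0 < 1 - t - 2 * b" using n D0 by (smt (verit) mult_nonneg_nonpos)
        have "B * n \<le> B * (D * (1 - t - 2 * b))"
          using nD B0 by (rule mult_left_mono)
        then have "((t + b) * (1 + t)) * D \<le> (B * (1 - t - 2 * b)) * D" using Bn by (simp add: ac_simps)
        then have "(t + b) * (1 + t) \<le> B * (1 - t - 2 * b)" using D0 by (rule mult_right_le_imp_le)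
        also have "\<dots> \<le> B * (1 - b)^3"
        proof (rule mult_left_mono[OF _ B0])
          have "(1 - b)^3 = 1 - 3 * b + b\<^sup>2 * (3 - b)" by (simp add: power2_eq_square power3_eq_cube algebra_simps)
          moreover have "0 \<le> b\<^sup>2 * (3 - b)" using b1 by auto
          ultimately show "1 - t - 2 * b \<le> (1 - b)^3" using bt by linarith
        qed
        finally have L: "(t + b) * (1 + t) \<le> (1 - b)\<^sup>2 * A" by (simp add: A_def power2_eq_square power3_eq_cube algebra_simps)
        have b3: "b \<le> 1/3" using pos bt by linarith
        have R: "((1 + b)^3 + 4 * b * t) * \<delta> \<le> (t + b) * (1 + t)"
        proof -
          \<comment> \<open>For b at most 1/3 and t below 1/2 the sum is at most 3 + 1 + 1/9 + 2.
            Below, \<open>2 * b\<close> absorbs \<open>4 * b * t\<close>, and what remains of the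
            mixed term is completed to \<open>(t - 3/5 * b)^2\<close>.\<close>
          have "3 + 3 * b + b\<^sup>2 + 4 * t \<le> 31/5"
            using b3 b t mult_mono[of b "1/3" b "1/3"] by (simp add: power2_eq_square)
          then have "(b * (t - b)) * (3 + 3 * b + b\<^sup>2 + 4 * t) \<le> (b * (t - b)) * (31/5)"
            using b bt by (intro mult_left_mono) auto
          moreover have "(b * (t - b)) * (31/5) = 31/5 * (b * t) - 31/5 * (b * b)"
            by (simp add: field_simps)
          moreover have "0 \<le> t * t - 6/5 * (b * t) + 9/25 * (b * b)"
            using zero_le_power2[of "t - 3/5 * b"] by (simp add: power2_eq_square field_simps)
          moreover have "(t + b) * (1 + t) - ((1 + b)^3 + 4 * b * t) * \<delta>
              = t * t + 2 * b + b * t - (b * (t - b)) * (3 + 3 * b + b\<^sup>2 + 4 * t)"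
            by (simp add: \<delta>_def power2_eq_square power3_eq_cube algebra_simps)
          moreover have "b * t \<le> b * (1/2)" using t b by (intro mult_left_mono) auto
          ultimately show ?thesis using zero_le_square[of b] by linarith
        qed
        have "(1 + b)\<^sup>2 * ((A - \<delta>) * (A - b * \<delta>)) - b * (2 * A + t * \<bar>\<delta>\<bar>)\<^sup>2
            = A * ((1 - b)\<^sup>2 * A - ((1 + b)^3 + 4 * b * t) * \<delta>) + b * \<delta>\<^sup>2 * ((1 + b)\<^sup>2 - t\<^sup>2)"
          using True by (simp add: power2_eq_square power3_eq_cube algebra_simps)
        also have "\<dots> \<ge> 0" using L R by (intro add_nonneg_nonneg b2t mult_nonneg_nonneg A0) auto
        finally show ?thesis by simp
      next
        case False
        have q: "4 * b * t \<le> (1 + b)^3"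
        proof -
          have "4 * b * t \<le> 4 * b * 1" using t b by (intro mult_left_mono) auto
          also have "\<dots> \<le> (1 + b)^3"
          proof -
            have "(1 + b)^3 - 4 * b = (1 - b)\<^sup>2 + b * (1 + 2 * b + b\<^sup>2)"
              by (simp add: power2_eq_square power3_eq_cube algebra_simps)
            also have "\<dots> \<ge> 0" using b by auto
            finally show ?thesis by simp
          qed
          finally show ?thesis .
        qed
        have "(1 + b)\<^sup>2 * ((A - \<delta>) * (A - b * \<delta>)) - b * (2 * A + t * \<bar>\<delta>\<bar>)\<^sup>2
            = (1 - b)\<^sup>2 * A\<^sup>2 + A * (- \<delta>) * ((1 + b)^3 - 4 * b * t) + b * \<delta>\<^sup>2 * ((1 + b)\<^sup>2 - t\<^sup>2)"
          using False by (simp add: power2_eq_square power3_eq_cube algebra_simps)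
        also have "\<dots> \<ge> 0" using q False
          by (intro add_nonneg_nonneg b2t mult_nonneg_nonneg A0) auto
        finally show ?thesis by simp
      qed
      then have "b * (b * (2 * A + t * \<bar>\<delta>\<bar>)\<^sup>2) \<le> b * ((1 + b)\<^sup>2 * ((A - \<delta>) * (A - b * \<delta>)))"
        using b by (rule mult_left_mono)
      then have 3: "((1 + b) * p12 s)\<^sup>2 \<le> (1 + b)\<^sup>2 * (p11 s * (b * (B * (1 - b) - b * \<delta>)))"
        using p12' unfolding p11 A_def[symmetric] by (simp add: algebra_simps)
      show ?thesis using 1 2 3 by blast
    next

      \<comment> \<open>Minimizer at the endpoint x = 1\<close>
      case II
      have s: "\<bar>\<kappa> - 2 * a * b * (- 2)\<bar> = - \<kappa> - 4 * a * b" using II by simp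
      have 1: "0 \<le> c0 - a * b * (- 2)\<^sup>2 - 2 * \<bar>\<kappa> - 2 * a * b * (- 2)\<bar>"
        using freq[of 1] unfolding s by simp
      have le: "b * (1 + t) \<le> a * (t * (1 + b) - 4 * b)" using II by (simp add: \<kappa>_def algebra_simps)
      \<comment> \<open>A very negative \<open>\<kappa>\<close> forces \<open>b\<close> to be small
        relative to \<open>t\<close>; this smallness carries the final determinant estimate.\<close>
      have bt: "4 * b \<le> t * (1 + b)"
      proof (rule ccontr)
        assume c: "\<not> ?thesis"
        then have "a * (t * (1 + b) - 4 * b) \<le> 0" using a0 by (intro mult_nonneg_nonpos) auto
        then have "b * (1 + t) \<le> 0" using le by linarith
        then have "b = 0" using b t by (auto simp: mult_le_0_iff)
        then show False using c t by simp
      qed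
      have b2: "b \<le> 1/7"
      proof -
        have "t * (1 + b) \<le> 1/2 * (1 + b)" using t b by (intro mult_right_mono) auto
        with bt have "4 * b \<le> 1/2 * (1 + b)" by (rule order_trans)
        then show ?thesis by (simp add: field_simps)
      qed
      have d0: "0 \<le> \<delta>"
      proof -
        have "t * b \<le> t * 1" using t b1 by (intro mult_left_mono) auto
        then show ?thesis using bt t by (simp add: \<delta>_def algebra_simps)
      qed
      have p11: "p11 (-2) = B * (1 + 3 * b - t - t * b) + b * D * (1 + t) - \<delta>"
        unfolding p11_def s by (simp add: \<kappa>_def B_def \<delta>_def algebra_simps)
      have "0 \<le> b * D * (1 + t)" using b D0 t by auto
      then have p11': "4 * b * B \<le> p11 (-2)"
        unfolding p11 using core tbL by (simp add: algebra_simps)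
      have 2: "0 \<le> p11 (-2)" using p11' b B0 mult_nonneg_nonneg[of "4 * b" B] by linarith
      define i where "i = 2 * B * (1 + b) - B * t * (1 + b) + b * D * (1 + t) - t * \<delta>"
      have p12: "(1 + b) * p12 (-2) = b * (- i)"
        unfolding p12_def i_def by (simp add: B_def \<delta>_def D_def algebra_simps)
      have tB: "t * \<delta> \<le> 1 * B" using t d0 B\<delta> by (intro mult_mono) auto
      have i0: "0 \<le> i"
      proof -
        have "B * t * (1 + b) \<le> B * 1 * (1 + b)" using B0 b t by (intro mult_right_mono mult_left_mono) auto
        moreover have "0 \<le> B * b" using B0 b by simp
        ultimately show ?thesis unfolding i_def using tB \<open>0 \<le> b * D * (1 + t)\<close> by (simp add: algebra_simps)
      qed
      have i1: "i \<le> 2 * B * (1 - b)"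
      proof -
        have "D * (\<kappa> + 4 * a * b) \<le> 0" using II D0 by (simp add: mult_le_0_iff)
        moreover have "0 \<le> t * \<delta>" using t d0 by simp
        ultimately show ?thesis unfolding i_def by (simp add: \<kappa>_def B_def algebra_simps)
      qed
      have "((1 + b) * p12 (-2))\<^sup>2 = b * b * i\<^sup>2" unfolding p12 by (simp add: power2_eq_square)
      also have "\<dots> \<le> b * b * (2 * B * (1 - b))\<^sup>2"
        using i0 i1 by (intro mult_left_mono power_mono) auto
      also have "\<dots> = 4 * b * b * B * B * (1 - b)\<^sup>2" by (simp add: power2_eq_square)
      also have "\<dots> \<le> 4 * b * b * B * B * ((1 + b)\<^sup>2 * (1 - 2 * b))"
      proof (rule mult_left_mono)
        have "(1 + b)\<^sup>2 * (1 - 2 * b) - (1 - b)\<^sup>2 = 2 * b * (1 - 2 * b - b * b)"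
          by (simp add: power2_eq_square algebra_simps)
        moreover have "b * b \<le> 1/7 * 1" using b b2 by (intro mult_mono) auto
        ultimately show "(1 - b)\<^sup>2 \<le> (1 + b)\<^sup>2 * (1 - 2 * b)"
          using b b2 mult_nonneg_nonneg[of "2 * b" "1 - 2 * b - b * b"] by linarith
      qed (use B0 b in auto)
      also have "\<dots> = (1 + b)\<^sup>2 * ((4 * b * B) * (b * (B * (1 - 2 * b))))" by (simp add: algebra_simps)
      also have "\<dots> \<le> (1 + b)\<^sup>2 * (p11 (-2) * (b * (B * (1 - b) - b * \<delta>)))"
      proof (intro mult_left_mono mult_mono p11' 2)
        have "b * \<delta> \<le> b * B" using B\<delta> b by (intro mult_left_mono)
        then show "B * (1 - 2 * b) \<le> B * (1 - b) - b * \<delta>" by (simp add: algebra_simps)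
      qed (use B0 b b2 in auto)
      finally have 3: "((1 + b) * p12 (-2))\<^sup>2 \<le> (1 + b)\<^sup>2 * (p11 (-2) * (b * (B * (1 - b) - b * \<delta>)))" .
      show ?thesis using 1 2 3 by blast
    next

      \<comment> \<open>Minimizer at the endpoint x = -1\<close>
      case III
      have s: "\<bar>\<kappa> - 2 * a * b * 2\<bar> = \<kappa> - 4 * a * b" using III by simp
      have 1: "0 \<le> c0 - a * b * 2\<^sup>2 - 2 * \<bar>\<kappa> - 2 * a * b * 2\<bar>"
        using freq[of "-1"] unfolding s by simp
      \<comment> \<open>Multiplying the case assumption by \<open>n\<close> removes
        \<open>a\<close>; dividing by \<open>b\<close> then confines both parameters to a small
        region.\<close>
      have tb: "5 * t + 4 * b \<le> 1"
      proof -
        have "(a * n) * (t * (1 + b) + 4 * b) \<le> (b * (1 + t)) * n"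
          using III n mult_right_mono[of "a * (t * (1 + b) + 4 * b)" "b * (1 + t)" n]
          by (simp add: \<kappa>_def algebra_simps)
        then have "(1 + t) * ((t + b) * (t * (1 + b) + 4 * b)) \<le> (1 + t) * (b * n)"
          unfolding a by (simp add: algebra_simps)
        then have "(t + b) * (t * (1 + b) + 4 * b) \<le> b * n" using t by simp
        also have "\<dots> \<le> b * 1" using n1 b by (intro mult_left_mono) auto
        finally have *: "(t + b) * (t * (1 + b) + 4 * b) \<le> b" by simp
        have eq: "(t + b) * (t * (1 + b) + 4 * b) = t * t + t * t * b + t * b * b + b * (5 * t + 4 * b)"
          by (simp add: algebra_simps)
        have "0 \<le> t * t * b" "0 \<le> t * b * b" using t b by auto
        show ?thesis
        proof (cases "b = 0")
          case True then show ?thesis using * t by (auto simp: mult_le_0_iff)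
        next
          case False
          have "b * (5 * t + 4 * b) \<le> b * 1"
            using * eq \<open>0 \<le> t * t * b\<close> \<open>0 \<le> t * b * b\<close> zero_le_square[of t] by linarith
          then show ?thesis using False b by simp
        qed
      qed
      have b4: "b \<le> 1/4" and t5: "t \<le> 1/5" using tb t b by linarith+
      have p11: "p11 2 = B * (1 + 3 * b + t * (1 + b)) - b * D * (1 + t) - \<delta>"
        unfolding p11_def s by (simp add: \<kappa>_def B_def \<delta>_def algebra_simps)
      have key: "b * D * (1 + t) + \<delta> \<le> B * (1 - b - t/4)"
      \<comment> \<open>For \<open>D \<le> 1\<close>, that is b at most t, \<open>BL\<close>
        suffices. Otherwise the factor \<open>D\<close> enlarges the left side, and
        \<open>Bn\<close> with n at most 1 supplies a bound on \<open>B\<close> containing the same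
        factor.\<close>
      proof (cases "D \<le> 1")
        case True
        have "b * D * (1 + t) \<le> b * 1 * (1 + t)"
          using True b t by (intro mult_right_mono mult_left_mono) auto
        moreover have "(t + b) * (1 + t) * (1 - b - t/4) \<le> B * (1 - b - t/4)"
          using BL b4 t5 by (intro mult_right_mono) auto
        moreover have "0 \<le> (t + b) * (1 + t) * (1 - b - t/4) - (b * 1 * (1 + t) + \<delta>)"
        proof -
          have "(t + b) * (1 + t) * (1 - b - t/4) - (b * 1 * (1 + t) + \<delta>)
              = t * t * (3/4 - t/4) + b * (1 - b - b * t - 5/4 * t - 5/4 * (t * t))"
            by (simp add: \<delta>_def field_simps)
          also have "\<dots> \<ge> 0"
          proof (intro add_nonneg_nonneg mult_nonneg_nonneg)
            have "b * t \<le> 1/4 * (1/5)" "t * t \<le> 1/5 * (1/5)"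
              using b b4 t t5 by (intro mult_mono; simp)+
            then show "0 \<le> 1 - b - b * t - 5/4 * t - 5/4 * (t * t)" using b4 t5 by linarith
          qed (use t t5 b in auto)
          finally show ?thesis .
        qed
        ultimately show ?thesis by linarith
      next
        case False
        then have tb': "t \<le> b" by (simp add: D_def)
        define W where "W = D * (1 + t)"
        have "1 * 1 \<le> W" "W \<le> 5/4 * (6/5)"
          unfolding W_def using False t t5 b4 by (intro mult_mono; simp add: D_def)+
        then have W: "1 \<le> W" "W \<le> 3/2" by auto
        have "B * n \<le> B * 1" using n1 b B0 by (intro mult_left_mono) auto
        then have "(t + b) * W \<le> B" using Bn by (simp add: W_def algebra_simps)
        then have "(t + b) * W * (1 - b - t/4) \<le> B * (1 - b - t/4)"
          using b4 t5 by (intro mult_right_mono) auto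
        moreover have "0 \<le> (t + b) * W * (1 - b - t/4) - (b * W + \<delta>)"
        proof -
          have "(t + b) * W * (1 - b - t/4) - (b * W + \<delta>)
              = (t * ((W - 1) * (1 - b - t/4)) + (b - t) * (b + t/4)) + b * (1 - (W + 1) * (b + t/4))"
            by (simp add: \<delta>_def field_simps)
          also have "\<dots> \<ge> 0"
          proof (intro add_nonneg_nonneg mult_nonneg_nonneg)
            have "(W + 1) * (b + t/4) \<le> 5/2 * (3/10)" using W b b4 t t5 by (intro mult_mono) auto
            then show "0 \<le> 1 - (W + 1) * (b + t/4)" by linarith
          qed (use t t5 b b4 W tb' in auto)
          finally show ?thesis .
        qed
        ultimately show ?thesis by (simp add: W_def algebra_simps)
      qed
      \<comment> \<open>The slack \<open>t/4\<close> in \<open>key\<close> was made for this: it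
        leaves \<open>5/4 * t\<close>, which covers \<open>5 * b * t\<close> because b is at most
        1/4. The factor \<open>1 + 3/2 * t\<close> pays for the extra \<open>t/2\<close> in
        \<open>i2\<close> below.\<close>
      have p11': "4 * b * B * (1 + 3/2 * t) \<le> p11 2"
      proof -
        have "B * (1 - b - t/4) \<le> B * (1 - b + t - 5 * b * t)"
          using B0 b4 t mult_right_mono[of b "1/4" t] by (intro mult_left_mono) auto
        then show ?thesis unfolding p11 using key by (simp add: algebra_simps)
      qed
      have "0 \<le> 4 * b * B * (1 + 3/2 * t)" using b B0 t by (intro mult_nonneg_nonneg) auto
      then have 2: "0 \<le> p11 2" using p11' by (rule order_trans)
      define i where "i = 2 * B * (1 + b) + B * t * (1 + b) - b * D * (1 + t) + t * \<delta>"
      have p12: "(1 + b) * p12 2 = b * i"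
        unfolding p12_def i_def by (simp add: B_def \<delta>_def D_def algebra_simps)
      have i0: "0 \<le> i"
      proof -
        have "0 \<le> (t + b) * (1 + t) + (1 + t) * \<delta>" using t by (simp add: \<delta>_def algebra_simps)
        then have "0 \<le> B + (1 + t) * \<delta>" using BL by linarith
        moreover have "0 \<le> B * b" "0 \<le> B * t" "0 \<le> B * t * b" using B0 b t by auto
        ultimately show ?thesis unfolding i_def using key by (simp add: algebra_simps)
      qed
      have i1: "i \<le> 2 * B * (1 - b) + t * \<delta>"
      proof -
        have "0 \<le> D * (\<kappa> - 4 * a * b)" using III D0 by simp
        then show ?thesis unfolding i_def by (simp add: \<kappa>_def B_def algebra_simps)
      qed
      have sq: "((1 + b) * p12 2)\<^sup>2 = b * b * i\<^sup>2" unfolding p12 by (simp add: power2_eq_square)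
      have 3: "((1 + b) * p12 2)\<^sup>2 \<le> (1 + b)\<^sup>2 * (p11 2 * (b * (B * (1 - b) - b * \<delta>)))"
      proof (cases "0 \<le> \<delta>")
        case True
        have "t * \<delta> \<le> t * B" using B\<delta> t by (intro mult_left_mono)
        then have i2: "i \<le> 2 * B * (1 - b + t/2)" using i1 by (simp add: algebra_simps)
        have "b * b * i\<^sup>2 \<le> b * b * (2 * B * (1 - b + t/2))\<^sup>2"
          using i0 i2 by (intro mult_left_mono power_mono) auto
        also have "\<dots> = 4 * b * b * B * B * (1 - b + t/2)\<^sup>2" by (simp add: power2_eq_square)
        also have "\<dots> \<le> 4 * b * b * B * B * ((1 + b)\<^sup>2 * (1 - 2 * b) * (1 + 3/2 * t))"
        proof (rule mult_left_mono)
          have bb: "b * b \<le> 1/4 * b" using b b4 by (intro mult_right_mono) auto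
          have "b * (b * b) \<le> 1/4 * (1/4 * b)" using b b4 bb by (intro mult_mono) auto
          have m: "(1 + b)\<^sup>2 * (1 - 2 * b) = 1 - 3 * (b * b) - 2 * (b * (b * b))"
            by (simp add: power2_eq_square algebra_simps)
          have m1: "(1 - b)\<^sup>2 \<le> (1 + b)\<^sup>2 * (1 - 2 * b)" unfolding m
            using bb \<open>b * (b * b) \<le> _\<close> b by (simp add: power2_eq_square algebra_simps)
          \<comment> \<open>7/10 suffices because \<open>7/10 * 3/2 = 1 + 1/20\<close> dominates
            \<open>1 - b + t/4\<close> for t at most 1/5.\<close>
          have m2: "7/10 \<le> (1 + b)\<^sup>2 * (1 - 2 * b)" unfolding m
            using bb \<open>b * (b * b) \<le> _\<close> b4 by linarith
          have "(1 - b + t/2)\<^sup>2 = (1 - b)\<^sup>2 + t * (1 - b) + t * t / 4"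
            by (simp add: power2_eq_square field_simps)
          also have "\<dots> \<le> (1 + b)\<^sup>2 * (1 - 2 * b) + 7/10 * (3/2 * t)"
          proof -
            have "t * t \<le> 1/5 * t" "0 \<le> t * b" using t t5 b mult_right_mono[of t "1/5" t] by auto
            then show ?thesis using m1 t by (simp add: algebra_simps)
          qed
          also have "\<dots> \<le> (1 + b)\<^sup>2 * (1 - 2 * b) + (1 + b)\<^sup>2 * (1 - 2 * b) * (3/2 * t)"
            using m2 t by (intro add_left_mono mult_right_mono) auto
          finally show "(1 - b + t/2)\<^sup>2 \<le> (1 + b)\<^sup>2 * (1 - 2 * b) * (1 + 3/2 * t)"
            by (simp add: algebra_simps)
        qed (use B0 b in auto)
        also have "\<dots> = (1 + b)\<^sup>2 * ((4 * b * B * (1 + 3/2 * t)) * (b * (B * (1 - 2 * b))))"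
          by (simp only: ac_simps)
        also have "\<dots> \<le> (1 + b)\<^sup>2 * (p11 2 * (b * (B * (1 - b) - b * \<delta>)))"
        proof (intro mult_left_mono mult_mono p11' 2)
          have "b * \<delta> \<le> b * B" using B\<delta> b by (intro mult_left_mono)
          then show "B * (1 - 2 * b) \<le> B * (1 - b) - b * \<delta>" by (simp add: algebra_simps)
        qed (use B0 b b4 in auto)
        finally show ?thesis unfolding sq .
      next
        case False
        then have "t * \<delta> \<le> 0" "b * \<delta> \<le> 0" using t b by (auto simp: mult_le_0_iff)
        have i2: "i \<le> 2 * B * (1 - b)" using i1 \<open>t * \<delta> \<le> 0\<close> by linarith
        have "b * b * i\<^sup>2 \<le> b * b * (2 * B * (1 - b))\<^sup>2"
          using i0 i2 by (intro mult_left_mono power_mono) auto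
        also have "\<dots> = (4 * b * B) * (b * (B * (1 - b))) * (1 - b)" by (simp add: power2_eq_square)
        also have "\<dots> \<le> (p11 2 * (b * (B * (1 - b) - b * \<delta>))) * (1 + b)\<^sup>2"
        proof (intro mult_mono 2)
          have "4 * b * B * 1 \<le> 4 * b * B * (1 + 3/2 * t)"
            using b B0 t by (intro mult_left_mono) auto
          then show "4 * b * B \<le> p11 2" using p11' by linarith
          show "B * (1 - b) \<le> B * (1 - b) - b * \<delta>" using \<open>b * \<delta> \<le> 0\<close> by linarith
          have "1 \<le> (1 + b)\<^sup>2" using b by simp
          then show "1 - b \<le> (1 + b)\<^sup>2" using b by linarith
        qed (use B0 b b1 2 P22' in auto)
        finally show ?thesis unfolding sq by (simp add: mult.commute)
      qed
      show ?thesis using 1 2 3 by blast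
    qed
  qed
  then obtain s where s: "0 \<le> c0 - a * b * s\<^sup>2 - 2 * \<bar>\<kappa> - 2 * a * b * s\<bar>" "0 \<le> p11 s"
      "(p12 s)\<^sup>2 \<le> p11 s * (b * (B * (1 - b) - b * \<delta>))"
    using b by (auto simp: power_mult_distrib)
  show thesis
  proof (rule that[of "a * (1 - b) - \<bar>\<kappa> - 2 * a * b * s\<bar>" s "a * b * s - b * (1 + t - a * t)"])
  qed (use s b P22' in \<open>auto simp: P22 p11_def p12_def c0_def\<close>)
qed

lemma inertial_lyapunov:
  fixes t b a :: real
  assumes t: "0 \<le> t" "t < 1/2" and b: "0 \<le> b" and n: "0 < (1 - t)\<^sup>2 - b * (1 + t)"
    and a: "a * ((1 - t)\<^sup>2 - b * (1 + t)) = (t + b) * (1 + t)"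
  obtains V :: "'a::real_inner \<Rightarrow> 'a \<Rightarrow> 'a \<Rightarrow> real" where
    "\<And>w d e. 0 \<le> V w d e"
    "\<And>w d e v. V v (v - w) d - V w d e
        \<le> (norm v)\<^sup>2 + a * (norm (v - (w + t *\<^sub>R d - b *\<^sub>R e)))\<^sup>2
          - (norm (w + t *\<^sub>R d - b *\<^sub>R e))\<^sup>2"
proof -
  define \<kappa> where "\<kappa> = b * (1 + t) - a * t * (1 + b)"
  define D where "D = 1 - t + b"
  define e22 where "e22 = b * (1 - b) * (a - 1)"
  obtain e11 e12 s where e11: "e11 = a * (1 - b) - \<bar>\<kappa> - 2 * a * b * s\<bar>"
    and e12: "e12 = a * b * s - b * (1 + t - a * t)"
    and R: "0 \<le> a * ((1 - b)\<^sup>2 + t\<^sup>2) - t * (1 + t) + b * (1 - b)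
           - a * b * s\<^sup>2 - 2 * \<bar>\<kappa> - 2 * a * b * s\<bar>"
    and P: "0 \<le> D * e11 - (t - b)" "0 \<le> D * e22 + b * (1 - t)"
      "(D * e12 + b)\<^sup>2 \<le> (D * e11 - (t - b)) * (D * e22 + b * (1 - t))"
    using lyapunov_parameter[OF t b n a] unfolding \<kappa>_def D_def e22_def by metis
  \<comment> \<open>The weights 1, -t, b belong to three consecutive distances to p. Their increment
    matches \<open>|v|^2 - |y|^2\<close> up to differences of iterates, since y is an affine
    combination of the iterates with coefficients \<open>1 + t\<close>, \<open>- (t + b)\<close>,
    \<open>b\<close>. The form in \<open>d\<close>, \<open>e\<close> handles the
    differences.\<close>
  define V :: "'a \<Rightarrow> 'a \<Rightarrow> 'a \<Rightarrow> real" where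
    "V w d e = (norm w)\<^sup>2 - t * (norm (w - d))\<^sup>2 + b * (norm (w - d - e))\<^sup>2
        + e11 * (norm d)\<^sup>2 + 2 * e12 * (d \<bullet> e) + e22 * (norm e)\<^sup>2" for w d e
  have D0: "0 < D" using t b by (simp add: D_def)
  have a0: "0 \<le> a"
  proof -
    have "0 \<le> a * ((1 - t)\<^sup>2 - b * (1 + t))" using a t b by auto
    then show ?thesis using n by (simp add: zero_le_mult_iff)
  qed
  have "0 \<le> V w d e" for w d e
  proof -
    \<comment> \<open>\<open>D\<close> is the coefficient of \<open>|w|^2\<close> in
      \<open>V\<close>; completing the square in \<open>w\<close> leaves the Schur
      complement.\<close>
    have "D * V w d e = (norm (D *\<^sub>R w + (t - b) *\<^sub>R d - b *\<^sub>R e))\<^sup>2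
        + ((D * e11 - (t - b)) * (norm d)\<^sup>2 + 2 * (D * e12 + b) * (d \<bullet> e)
          + (D * e22 + b * (1 - t)) * (norm e)\<^sup>2)"
      unfolding V_def D_def power2_norm_eq_inner
      by (simp add: inner_simps inner_commute power2_eq_square algebra_simps)
    also have "\<dots> \<ge> 0" by (rule add_nonneg_nonneg[OF zero_le_power2 quad_form_nonneg[OF P]])
    finally show ?thesis using D0 by (simp add: zero_le_mult_iff)
  qed
  moreover have "V v (v - w) d - V w d e
        \<le> (norm v)\<^sup>2 + a * (norm (v - (w + t *\<^sub>R d - b *\<^sub>R e)))\<^sup>2
          - (norm (w + t *\<^sub>R d - b *\<^sub>R e))\<^sup>2" (is "_ \<le> ?S") for w d e v
  proof -
    define p where "p = v - w"
    define \<sigma> :: real where "\<sigma> = (if \<kappa> - 2 * a * b * s \<ge> 0 then 1 else - 1)"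
    have \<sigma>: "\<sigma> * \<bar>\<kappa> - 2 * a * b * s\<bar> = \<kappa> - 2 * a * b * s" "\<sigma> * \<sigma> = 1" by (auto simp: \<sigma>_def)
    define m where "m = \<bar>\<kappa> - 2 * a * b * s\<bar>"
    have \<sigma>m: "\<sigma> * m = b * (1 + t) - a * t * (1 + b) - 2 * a * b * s"
      using \<sigma> by (simp add: m_def \<kappa>_def)
    have sq: "m * (norm (p + \<sigma> *\<^sub>R d))\<^sup>2 = m * (p \<bullet> p) + 2 * (\<sigma> * m) * (p \<bullet> d) + (\<sigma> * \<sigma>) * m * (d \<bullet> d)"
      unfolding power2_norm_eq_inner by (simp add: inner_simps inner_commute algebra_simps)
    have v: "v = w + p" by (simp add: p_def)
    have "?S - (V v p d - V w d e)
        = a * b * (norm (p + s *\<^sub>R d + e))\<^sup>2 + m * (norm (p + \<sigma> *\<^sub>R d))\<^sup>2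
          + (a * ((1 - b)\<^sup>2 + t\<^sup>2) - t * (1 + t) + b * (1 - b) - a * b * s\<^sup>2 - 2 * m) * (norm d)\<^sup>2"
      unfolding sq unfolding \<sigma>m \<sigma>(2) V_def v e11 m_def[symmetric] e12 e22_def power2_norm_eq_inner
      by (simp add: inner_simps inner_commute power2_eq_square algebra_simps)
    also have "\<dots> \<ge> 0"
      using R a0 b unfolding m_def[symmetric]
      by (intro add_nonneg_nonneg mult_nonneg_nonneg) (auto simp: m_def)
    finally show ?thesis by (simp add: p_def)
  qed
  ultimately show thesis by (rule that)
qed

text \<open>Boundedness of the extrapolated points requires \<open>V\<close> to control them, which
  is more than \<open>V\<close> being nonnegative.\<close>

lemma inertial_lyapunov_coercive:
  fixes t b a :: real
  assumes t: "0 \<le> t" "t < 1/2" and b: "0 \<le> b" and n: "0 < (1 - t)\<^sup>2 - b * (1 + t)"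
    and a: "a * ((1 - t)\<^sup>2 - b * (1 + t)) = (t + b) * (1 + t)"
  obtains V :: "'a::real_inner \<Rightarrow> 'a \<Rightarrow> 'a \<Rightarrow> real" where
    "\<And>w d e. (norm (w + t *\<^sub>R d - b *\<^sub>R e))\<^sup>2 \<le> (1 + a) * V w d e"
    "\<And>w d e v. V v (v - w) d - V w d e
        \<le> (norm v)\<^sup>2 + a * (norm (v - (w + t *\<^sub>R d - b *\<^sub>R e)))\<^sup>2
          - (norm (w + t *\<^sub>R d - b *\<^sub>R e))\<^sup>2"
proof -
  have a0: "0 \<le> a"
  proof -
    have "0 \<le> a * ((1 - t)\<^sup>2 - b * (1 + t))" using a t b by auto
    then show ?thesis using n by (simp add: zero_le_mult_iff)
  qed
  obtain V :: "'a \<Rightarrow> 'a \<Rightarrow> 'a \<Rightarrow> real" where V0: "\<And>w d e. 0 \<le> V w d e"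
    and V1: "\<And>w d e v. V v (v - w) d - V w d e
        \<le> (norm v)\<^sup>2 + a * (norm (v - (w + t *\<^sub>R d - b *\<^sub>R e)))\<^sup>2
          - (norm (w + t *\<^sub>R d - b *\<^sub>R e))\<^sup>2"
    using inertial_lyapunov[OF assms] by metis
  \<comment> \<open>Apply the increment bound to the fictitious step \<open>v = (a / (1 + a)) y\<close>, which minimizes its right-hand side.\<close>
  have "(norm (w + t *\<^sub>R d - b *\<^sub>R e))\<^sup>2 \<le> (1 + a) * V w d e" for w d e
  proof -
    define y where "y = w + t *\<^sub>R d - b *\<^sub>R e"
    define k where "k = 1 / (1 + a)"
    have k: "k * (k * (1 + a)) = k" using a0 by (simp add: k_def)
    have "0 \<le> V (y - k *\<^sub>R y) (y - k *\<^sub>R y - w) d" by (rule V0)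
    also have "\<dots> \<le> V w d e + (norm (y - k *\<^sub>R y))\<^sup>2 + a * (norm (y - k *\<^sub>R y - y))\<^sup>2 - (norm y)\<^sup>2"
      using V1[of "y - k *\<^sub>R y" w d e] unfolding y_def by linarith
    also have "\<dots> = V w d e + (k * (k * (1 + a)) - 2 * k) * (norm y)\<^sup>2"
      unfolding power2_norm_eq_inner by (simp add: inner_simps power2_eq_square algebra_simps)
    finally have "(norm y)\<^sup>2 * k \<le> V w d e" unfolding k by (simp add: mult.commute)
    then show ?thesis using a0 by (simp add: y_def k_def field_simps)
  qed
  then show thesis using V1 by (rule that)
qed

subsection \<open>The relaxed proximal step\<close>

lemma strongly_quasiconvex_on_midpoint:
  assumes g: "strongly_quasiconvex_on C \<gamma> g" and xy: "x \<in> C" "y \<in> C"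
  shows "midpoint x y \<in> C"
    and "g (midpoint x y) \<le> max (g x) (g y) - \<gamma> / 8 * (norm (x - y))\<^sup>2"
proof -
  have m: "midpoint x y = (1/2) *\<^sub>R y + (1 - 1/2) *\<^sub>R x"
    by (simp add: midpoint_def scaleR_add_right add.commute)
  show "midpoint x y \<in> C"
    unfolding m using g xy convexD_alt[of C x y "1/2"]
    by (simp add: strongly_quasiconvex_on_def add.commute)
  have "\<forall>\<mu>\<in>{0..1}. g (\<mu> *\<^sub>R y + (1 - \<mu>) *\<^sub>R x)
      \<le> max (g y) (g x) - \<mu> * (1 - \<mu>) * (\<gamma> / 2) * (norm (x - y))\<^sup>2"
    using g xy by (simp add: strongly_quasiconvex_on_def)
  from bspec[OF this, of "1/2"] show "g (midpoint x y) \<le> max (g x) (g y) - \<gamma> / 8 * (norm (x - y))\<^sup>2"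
    unfolding m by (simp add: max.commute)
qed

text \<open>Pseudomonotonicity gives only \<open>f z p \<le> 0\<close>. Inserting the midpoint of
  \<open>p\<close> and \<open>z\<close> yields a gain of \<open>\<gamma> / 8\<close>, because the
  maximum in quasiconvexity is then \<open>f z z = 0\<close>; splitting there by (A5) costs
  \<open>\<eta> / 2\<close>.\<close>

lemma EP_solution_gap:
  fixes f :: "'a::real_inner \<Rightarrow> 'a \<Rightarrow> real"
  assumes diag: "\<And>u. u \<in> C \<Longrightarrow> f u u = 0"
    and A2: "pseudomonotone_on C f"
    and A4: "\<And>u. u \<in> C \<Longrightarrow> strongly_quasiconvex_on C \<gamma> (f u)"
    and A5: "\<And>u v w. u \<in> C \<Longrightarrow> v \<in> C \<Longrightarrow> w \<in> C \<Longrightarrow>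
         f u w - f u v - f v w \<le> \<eta> * ((norm (u - v))\<^sup>2 + (norm (v - w))\<^sup>2)"
    and p: "p \<in> EP_solutions C f" and z: "z \<in> C"
  shows "f z p \<le> - (\<gamma> - 4 * \<eta>) / 8 * (norm (p - z))\<^sup>2"
proof -
  have pC: "p \<in> C" and le0: "f u p \<le> 0" if "u \<in> C" for u
    using p A2 that by (auto simp: EP_solutions_def pseudomonotone_on_def)
  define u where "u = midpoint p z"
  have uC: "u \<in> C" and sq: "f z u \<le> max (f z p) (f z z) - \<gamma> / 8 * (norm (p - z))\<^sup>2"
    using strongly_quasiconvex_on_midpoint[OF A4[OF z] pC[OF z] z] by (simp_all add: u_def)
  have "f z p - f z u - f u p \<le> \<eta> * ((norm (z - u))\<^sup>2 + (norm (u - p))\<^sup>2)"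
    using A5 z uC pC[OF z] by blast
  moreover have "norm (z - u) = norm (p - z) / 2" "norm (u - p) = norm (p - z) / 2"
    by (simp_all add: u_def dist_midpoint flip: dist_norm)
  ultimately have "f z p \<le> f z u + f u p + \<eta> * ((norm (p - z))\<^sup>2 / 2)"
    by (simp add: power_divide)
  then show ?thesis
    using sq le0[OF uC] le0[OF z] diag[OF z] by (simp add: field_simps)
qed

text \<open>The competitor of \<open>z\<close> is the midpoint of \<open>p\<close> and
  \<open>z\<close>. (A5) and the gap at \<open>p\<close> keep the maximum of \<open>f y p\<close>
  and \<open>f y z\<close> close to \<open>f y z\<close>, whichever is larger. The lower bound on
  \<open>l\<close> pays for the proximal term \<open>X / 4\<close> and leaves the surplus
  \<open>l * \<eta> * |p - z|^2\<close>.\<close>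

lemma prox_step_inequality:
  fixes f :: "'a::real_inner \<Rightarrow> 'a \<Rightarrow> real"
  assumes diag: "\<And>u. u \<in> C \<Longrightarrow> f u u = 0"
    and A2: "pseudomonotone_on C f"
    and A4: "\<And>u. u \<in> C \<Longrightarrow> strongly_quasiconvex_on C \<gamma> (f u)"
    and A5: "\<And>u v w. u \<in> C \<Longrightarrow> v \<in> C \<Longrightarrow> w \<in> C \<Longrightarrow>
         f u w - f u v - f v w \<le> \<eta> * ((norm (u - v))\<^sup>2 + (norm (v - w))\<^sup>2)"
    and \<eta>: "0 < \<eta>" "8 * \<eta> < \<gamma>" and l: "1 / (\<gamma> - 8 * \<eta>) < l"
    and p: "p \<in> EP_solutions C f" and y: "y \<in> C"
    and z: "is_arg_min (\<lambda>u. f y u + 1 / (2 * l) * (norm (y - u))\<^sup>2) (\<lambda>u. u \<in> C) z"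
  shows "(y - z) \<bullet> (p - z) \<le> 2 * l * \<eta> * (norm (y - z))\<^sup>2 - l * \<eta> * (norm (p - z))\<^sup>2"
proof -
  define X where "X = (norm (p - z))\<^sup>2"
  define Y where "Y = (norm (y - z))\<^sup>2"
  have XY: "0 \<le> X" "0 \<le> Y" by (auto simp: X_def Y_def)
  have pC: "p \<in> C" using p by (simp add: EP_solutions_def)
  have zC: "z \<in> C" using z by (simp add: is_arg_min_def)
  have l1: "1 < l * (\<gamma> - 8 * \<eta>)" using l \<eta> by (simp add: field_simps)
  have l0: "0 < l" using l \<eta> by (smt (verit) divide_pos_pos)
  define u where "u = midpoint p z"
  have uC: "u \<in> C" and sq: "f y u \<le> max (f y p) (f y z) - \<gamma> / 8 * X"
    using strongly_quasiconvex_on_midpoint[OF A4[OF y] pC zC] by (simp_all add: u_def X_def)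
  have argmin: "f y z + 1 / (2 * l) * (norm (y - z))\<^sup>2 \<le> f y u + 1 / (2 * l) * (norm (y - u))\<^sup>2"
    using z uC by (auto simp: is_arg_min_def not_less)
  have diff: "y - u = (y - z) - (1/2) *\<^sub>R (p - z)"
    using scaleR_add_left[of "1/2" "1/2" z]
    by (simp add: u_def midpoint_def algebra_simps)
  have yu: "(norm (y - u))\<^sup>2 = Y - (y - z) \<bullet> (p - z) + X / 4"
    unfolding diff X_def Y_def power2_norm_eq_inner by (simp add: inner_simps inner_commute field_simps)
  have 1: "1 / (2 * l) * ((y - z) \<bullet> (p - z)) \<le> f y u - f y z + 1 / (2 * l) * (X / 4)"
    using argmin unfolding yu Y_def[symmetric] distrib_left right_diff_distrib by linarith
  have "f y p - f y z - f z p \<le> \<eta> * (Y + X)"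
    using A5[OF y zC pC] by (simp add: X_def Y_def norm_minus_commute)
  then have "f y p - f y z \<le> \<eta> * (Y + X) - (\<gamma> - 4 * \<eta>) / 8 * X"
    using EP_solution_gap[OF diag A2 A4 A5 p zC] unfolding X_def[symmetric] by linarith
  also have "\<dots> \<le> \<eta> * Y + \<eta> / 2 * X"
    using mult_right_mono[of "8 * \<eta>" \<gamma> X] XY \<eta> by (simp add: field_simps)
  finally have "max (f y p) (f y z) - f y z \<le> \<eta> * Y + \<eta> / 2 * X"
    using XY \<eta> by (auto simp: max_def)
  then have "1 / (2 * l) * ((y - z) \<bullet> (p - z)) \<le> \<eta> * Y + \<eta> / 2 * X - \<gamma> / 8 * X + 1 / (2 * l) * (X / 4)"
    using 1 sq by linarith
  then have "2 * l * (1 / (2 * l) * ((y - z) \<bullet> (p - z)))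
      \<le> 2 * l * (\<eta> * Y + \<eta> / 2 * X - \<gamma> / 8 * X + 1 / (2 * l) * (X / 4))"
    using l0 by (intro mult_left_mono) auto
  also have "\<dots> = 2 * l * \<eta> * Y - l * \<eta> * X - (l * (\<gamma> - 8 * \<eta>) - 1) / 4 * X"
    using l0 by (simp add: field_simps)
  also have "\<dots> \<le> 2 * l * \<eta> * Y - l * \<eta> * X"
    using l1 XY by simp
  finally show ?thesis using l0 by (simp add: X_def Y_def)
qed

text \<open>Inserting the proximal bound into the expansion of \<open>|v - p|^2\<close> leaves
  \<open>r * (2 - 4 * \<eta> * l - r) * |y - z|^2\<close>. Since
  \<open>|v - y| = r * |y - z|\<close>, this is where \<open>alpha_min\<close> comes from.\<close>

lemma relaxed_step_inequality:
  fixes y z p :: "'a::real_inner"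
  assumes "(y - z) \<bullet> (p - z) \<le> 2 * l * \<eta> * (norm (y - z))\<^sup>2 - l * \<eta> * (norm (p - z))\<^sup>2"
    and r: "0 < r" and v: "v = (1 - r) *\<^sub>R y + r *\<^sub>R z"
  shows "(norm (v - p))\<^sup>2 + alpha_min \<eta> l r * (norm (v - y))\<^sup>2
           + 2 * r * l * \<eta> * (norm (p - z))\<^sup>2 \<le> (norm (y - p))\<^sup>2"
proof -
  have "(norm (v - p))\<^sup>2 = (norm (y - p))\<^sup>2 - 2 * r * (norm (y - z))\<^sup>2
      + 2 * r * ((y - z) \<bullet> (p - z)) + r\<^sup>2 * (norm (y - z))\<^sup>2"
    unfolding v power2_norm_eq_inner
    by (simp add: inner_simps inner_commute power2_eq_square algebra_simps)
  moreover have "v - y = r *\<^sub>R (z - y)" unfolding v by (simp add: algebra_simps)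
  then have "alpha_min \<eta> l r * (norm (v - y))\<^sup>2 = r * (2 - 4 * \<eta> * l - r) * (norm (y - z))\<^sup>2"
    using r by (simp add: alpha_min_def power_mult_distrib norm_minus_commute power2_eq_square)
  moreover have "2 * r * ((y - z) \<bullet> (p - z))
      \<le> 2 * r * (2 * l * \<eta> * (norm (y - z))\<^sup>2 - l * \<eta> * (norm (p - z))\<^sup>2)"
    using assms(1) r by (intro mult_left_mono) auto
  ultimately show ?thesis by (simp add: power2_eq_square algebra_simps)
qed

text \<open>Once \<open>Z\<close> tends to 0, the supply expression is at most
  \<open>- c * |Y|^2\<close> plus terms in \<open>Z\<close>. The mixed term
  \<open>Y n \<bullet> Z n\<close> is harmless only for bounded \<open>Y\<close>, which is the role
  of \<open>YU\<close>.\<close>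

lemma relaxed_steps_vanish:
  fixes Y Z v :: "nat \<Rightarrow> 'a::real_inner" and U r :: "nat \<Rightarrow> real"
  assumes a: "0 \<le> a" and c: "0 < c"
    and v: "\<And>n. v n = (1 - r n) *\<^sub>R Y n + r n *\<^sub>R Z n"
    and U: "\<And>n. U (Suc n) - U n \<le> (norm (v n))\<^sup>2 + a * (norm (v n - Y n))\<^sup>2 - (norm (Y n))\<^sup>2"
    and S: "\<And>n. (norm (v n))\<^sup>2 + a * (norm (v n - Y n))\<^sup>2 - (norm (Y n))\<^sup>2 \<le> - c * (norm (Z n))\<^sup>2"
    and YU: "\<And>n. (norm (Y n))\<^sup>2 \<le> (1 + a) * U n"
    and r: "\<And>n. 0 < r n" "\<And>n. r n \<le> 2" "\<And>n. c \<le> r n * (2 - r n - a * r n)"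
  shows "v \<longlonglongrightarrow> 0"
proof -
  have U0: "0 \<le> U n" for n
    using YU[of n] a zero_le_power2[of "norm (Y n)"] by (smt (verit) mult_pos_neg)
  have "decseq U"
  proof (rule decseq_SucI)
    show "U (Suc n) \<le> U n" for n
      using U[of n] S[of n] c by (smt (verit) mult_nonneg_nonneg zero_le_power2 minus_mult_left)
  qed
  then obtain L where L: "U \<longlonglongrightarrow> L" using decseq_convergent U0 by metis
  then have dU: "(\<lambda>n. U n - U (Suc n)) \<longlonglongrightarrow> 0"
    using tendsto_diff[OF L LIMSEQ_Suc[OF L]] by simp
  have Z2: "(\<lambda>n. (norm (Z n))\<^sup>2) \<longlonglongrightarrow> 0"
  proof (rule tendsto_sandwich[OF _ _ tendsto_const])
    show "(\<lambda>n. (U n - U (Suc n)) / c) \<longlonglongrightarrow> 0" using tendsto_divide[OF dU tendsto_const[of c]] c by simp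
    have "(norm (Z n))\<^sup>2 \<le> (U n - U (Suc n)) / c" for n
      using U[of n] S[of n] c by (simp add: field_simps)
    then show "\<forall>\<^sub>F n in sequentially. (norm (Z n))\<^sup>2 \<le> (U n - U (Suc n)) / c" by simp
  qed auto
  then have Z1: "(\<lambda>n. norm (Z n)) \<longlonglongrightarrow> 0" using tendsto_real_sqrt[OF Z2] by simp
  define R where "R = sqrt ((1 + a) * U 0)"
  have R: "norm (Y n) \<le> R" for n
  proof -
    have "(1 + a) * U n \<le> (1 + a) * U 0"
      using \<open>decseq U\<close> a by (intro mult_left_mono) (auto simp: decseq_def)
    then show ?thesis unfolding R_def using YU[of n] by (intro real_le_rsqrt) linarith
  qed
  have Y2: "(\<lambda>n. (norm (Y n))\<^sup>2) \<longlonglongrightarrow> 0"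
  proof (rule tendsto_sandwich[OF _ _ tendsto_const])
    \<comment> \<open>The numbers 4 and 8 bound the coefficients of the mixed term and of
      \<open>|Z|^2\<close> for relaxation parameters in (0, 2].\<close>
    let ?b = "\<lambda>n. ((U n - U (Suc n)) + (4 + 8 * a) * (R * norm (Z n)) + (4 + 4 * a) * (norm (Z n))\<^sup>2) / c"
    have "?b \<longlonglongrightarrow> (0 + (4 + 8 * a) * (R * 0) + (4 + 4 * a) * 0) / c"
      using c by (intro tendsto_intros dU Z1 Z2) auto
    then show "?b \<longlonglongrightarrow> 0" by simp
    have "(norm (Y n))\<^sup>2 \<le> ?b n" for n
    proof -
      define q where "q = r n * (2 - r n - a * r n)"
      define k where "k = 2 * r n * (1 - r n) - 2 * a * (r n)\<^sup>2"
      have eq: "(norm (v n))\<^sup>2 + a * (norm (v n - Y n))\<^sup>2 - (norm (Y n))\<^sup>2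
          = - (q * (norm (Y n))\<^sup>2) + k * (Y n \<bullet> Z n)
            + (1 + a) * (r n)\<^sup>2 * (norm (Z n))\<^sup>2"
        unfolding v power2_norm_eq_inner q_def k_def
        by (simp add: inner_simps inner_commute power2_eq_square algebra_simps)
      have r2: "(r n)\<^sup>2 \<le> 4" using r(1,2)[of n] power_mono[of "r n" 2 2] by simp
      have "\<bar>k\<bar> \<le> 4 + 8 * a"
      proof -
        have "\<bar>2 * r n * (1 - r n)\<bar> \<le> 2 * 2 * 1"
          unfolding abs_mult using r(1,2)[of n] by (intro mult_mono) auto
        moreover have "a * (r n)\<^sup>2 \<le> a * 4" "0 \<le> a * (r n)\<^sup>2" using r2 a by (auto intro: mult_left_mono)
        ultimately show ?thesis unfolding k_def by linarith
      qed
      moreover have "\<bar>Y n \<bullet> Z n\<bar> \<le> R * norm (Z n)"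
        using Cauchy_Schwarz_ineq2[of "Y n" "Z n"] mult_right_mono[OF R norm_ge_zero] by (rule order_trans)
      ultimately have "\<bar>k * (Y n \<bullet> Z n)\<bar> \<le> (4 + 8 * a) * (R * norm (Z n))"
        unfolding abs_mult using a by (intro mult_mono) auto
      then have "k * (Y n \<bullet> Z n) \<le> (4 + 8 * a) * (R * norm (Z n))" by (rule abs_le_D1)
      moreover have "(1 + a) * (r n)\<^sup>2 * (norm (Z n))\<^sup>2 \<le> (4 + 4 * a) * (norm (Z n))\<^sup>2"
        using mult_left_mono[OF r2, of "1 + a"] a by (intro mult_right_mono) auto
      moreover have "c * (norm (Y n))\<^sup>2 \<le> q * (norm (Y n))\<^sup>2"
        unfolding q_def using r(3) by (intro mult_right_mono) auto
      ultimately have "c * (norm (Y n))\<^sup>2 \<le> (U n - U (Suc n)) + (4 + 8 * a) * (R * norm (Z n))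
          + (4 + 4 * a) * (norm (Z n))\<^sup>2"
        using U[of n] unfolding eq by linarith
      then show ?thesis using c by (simp add: field_simps)
    qed
    then show "\<forall>\<^sub>F n in sequentially. (norm (Y n))\<^sup>2 \<le> ?b n" by simp
  qed auto
  have "(\<lambda>n. (norm (v n))\<^sup>2) \<longlonglongrightarrow> 0"
  proof (rule tendsto_sandwich[OF _ _ tendsto_const Y2])
    have "(norm (v n))\<^sup>2 \<le> (norm (Y n))\<^sup>2" for n
    proof -
      have "0 \<le> a * (norm (v n - Y n))\<^sup>2" "0 \<le> c * (norm (Z n))\<^sup>2" using a c by auto
      then show ?thesis using S[of n] by linarith
    qed
    then show "\<forall>\<^sub>F n in sequentially. (norm (v n))\<^sup>2 \<le> (norm (Y n))\<^sup>2" by simp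
  qed auto
  then have "(\<lambda>n. norm (v n)) \<longlonglongrightarrow> 0" using tendsto_real_sqrt by fastforce
  then show ?thesis by (simp add: tendsto_norm_zero_iff)
qed

subsection \<open>Convergence\<close>

theorem theorem3p7:
  fixes C :: "(real ^ 'n) set"
    and f :: "real ^ 'n \<Rightarrow> real ^ 'n \<Rightarrow> real"
    and \<gamma> \<eta> \<theta> \<beta> \<rho> \<epsilon> :: real
    and lam \<rho>s :: "nat \<Rightarrow> real"
    and x :: "int \<Rightarrow> real ^ 'n"
    and y z :: "nat \<Rightarrow> real ^ 'n"
  assumes C: "affine C" "C \<noteq> {}"
    and f_diag: "\<And>u. u \<in> C \<Longrightarrow> f u u = 0"
    and A1: "\<And>v. v \<in> C \<Longrightarrow> usc_on C (\<lambda>u. f u v)"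
    and A2: "pseudomonotone_on C f"
    and A3: "lsc_on (C \<times> C) (\<lambda>(u, v). f u v)"
    and A4: "\<gamma> > 0" "\<And>u. u \<in> C \<Longrightarrow> strongly_quasiconvex_on C \<gamma> (f u)"
    and A5: "\<eta> > 0"
      "\<And>u v w. u \<in> C \<Longrightarrow> v \<in> C \<Longrightarrow> w \<in> C \<Longrightarrow>
         f u w - f u v - f v w \<le> \<eta> * ((norm (u - v))\<^sup>2 + (norm (v - w))\<^sup>2)"
    and gamma_eta: "\<gamma> > 8 * \<eta>"
    and sol: "EP_solutions C f \<noteq> {}"
    and theta: "0 \<le> \<theta>" "\<theta> < 1 / 2"
    and beta: "\<beta> \<le> 0"
    and rho: "0 \<le> \<rho>" "\<rho> < 1"
    and lambda_pos: "\<And>k. k \<ge> 1 \<Longrightarrow> lam k > 0"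
    and rhos_pos: "\<And>k. k \<ge> 1 \<Longrightarrow> \<rho>s k > 0"
    and eps: "\<epsilon> > 0"
    and C1: "\<And>k. k \<ge> 1 \<Longrightarrow>
      1 / (\<gamma> - 8 * \<eta>) < lam k \<and> lam k < \<epsilon> \<and> \<epsilon> \<le> 1 / (4 * \<eta>)"
    and C2: "\<And>k. k \<ge> 1 \<Longrightarrow>
      0 < 1 - \<rho> \<and> 1 - \<rho> \<le> \<rho>s k \<and> \<rho>s k \<le> 1 + \<rho> \<and> 0 \<le> \<rho> \<and> \<rho> \<le> 1 - 4 * \<eta> * \<epsilon>"
    and C3: "\<And>k. k \<ge> 1 \<Longrightarrow>
      max (2 * \<theta> / alpha_min \<eta> (lam k) (\<rho>s k) - (1 - \<theta>))
          (\<theta> / (1 + alpha_max (\<rho>s k))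
             - alpha_min \<eta> (lam k) (\<rho>s k) * (\<theta> - 1)\<^sup>2
                 / ((1 + \<theta>) * (1 + alpha_max (\<rho>s k)))) < \<beta> \<and> \<beta> \<le> 0"
    and C4: "\<And>k. k \<ge> 1 \<Longrightarrow>
      \<theta>\<^sup>2 * (1 - alpha_min \<eta> (lam k) (\<rho>s k))
      + \<theta> * (1 - 2 * \<beta> + 2 * alpha_max (\<rho>s k) - 2 * alpha_min \<eta> (lam k) (\<rho>s k))
      - \<beta> * (1 - 2 * alpha_min \<eta> (lam k) (\<rho>s k))
      + \<beta>\<^sup>2 * (1 - alpha_min \<eta> (lam k) (\<rho>s k))
      - alpha_min \<eta> (lam k) (\<rho>s k) < 0"
    and run: "RTIPPA_EP C f \<theta> \<beta> lam \<rho>s x y z"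
  shows "\<exists>xs \<in> EP_solutions C f. (\<lambda>k. x (int k)) \<longlonglongrightarrow> xs"
proof -
  define b where "b = - \<beta>"
  define n where "n = (1 - \<theta>)\<^sup>2 - b * (1 + \<theta>)"
  define a where "a = (\<theta> + b) * (1 + \<theta>) / n"
  have b0: "0 \<le> b" using beta by (simp add: b_def)
  have bounds: "0 < n \<and> a \<le> alpha_min \<eta> (lam k) (\<rho>s k)" if k: "k \<ge> 1" for k
  proof -
    let ?m = "alpha_min \<eta> (lam k) (\<rho>s k)" and ?M = "alpha_max (\<rho>s k)"
    have r: "0 < \<rho>s k" using rhos_pos k by blast
    have "4 * \<eta> * lam k < 4 * \<eta> * \<epsilon>" using C1[OF k] A5(1) by simp
    then have "0 < 2 - 4 * \<eta> * lam k - \<rho>s k" using C2[OF k] by linarith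
    then have m0: "0 < ?m" using r by (simp add: alpha_min_def)
    have "0 < 4 * \<eta> * lam k" using lambda_pos[OF k] A5(1) by simp
    then have mM: "?m \<le> ?M"
      unfolding alpha_min_def alpha_max_def using r by (intro divide_right_mono) linarith+
    have d: "0 < (1 + \<theta>) * (1 + ?M)" using theta m0 mM by (intro mult_pos_pos) linarith+
    have "\<theta> / (1 + ?M) - ?m * (\<theta> - 1)\<^sup>2 / ((1 + \<theta>) * (1 + ?M)) < \<beta>"
      using C3[OF k] by simp
    also have "\<theta> / (1 + ?M) = \<theta> * (1 + \<theta>) / ((1 + \<theta>) * (1 + ?M))"
      using theta by simp
    finally have "(\<theta> * (1 + \<theta>) - ?m * (\<theta> - 1)\<^sup>2) / ((1 + \<theta>) * (1 + ?M)) < \<beta>"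
      by (simp add: diff_divide_distrib)
    then have "\<theta> * (1 + \<theta>) - ?m * (\<theta> - 1)\<^sup>2 < \<beta> * ((1 + \<theta>) * (1 + ?M))"
      using d by (simp add: pos_divide_less_eq)
    \<comment> \<open>As \<open>\<beta> \<le> 0\<close>, replacing \<open>alpha_max\<close> by the
      smaller \<open>alpha_min\<close> raises the right side and leaves a condition linear in
      \<open>alpha_min\<close>.\<close>
    also have "\<dots> \<le> \<beta> * ((1 + \<theta>) * (1 + ?m))"
      using beta theta mM by (intro mult_left_mono_neg mult_left_mono) auto
    finally have mn: "(\<theta> + b) * (1 + \<theta>) < ?m * n"
      by (simp add: n_def b_def power2_eq_square algebra_simps)
    moreover have "0 \<le> (\<theta> + b) * (1 + \<theta>)" using theta b0 by simp
    ultimately have "0 < ?m * n" by linarith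
    then have "0 < n" using m0 by (simp add: zero_less_mult_iff)
    then show ?thesis using mn by (simp add: a_def pos_divide_le_eq)
  qed
  have n0: "0 < n" using bounds[of 1] by simp
  have a0: "0 \<le> a" using theta b0 n0 by (simp add: a_def)
  obtain V :: "real ^ 'n \<Rightarrow> real ^ 'n \<Rightarrow> real ^ 'n \<Rightarrow> real" where
    V0: "\<And>w d e. (norm (w + \<theta> *\<^sub>R d - b *\<^sub>R e))\<^sup>2 \<le> (1 + a) * V w d e" and
    V1: "\<And>w d e v. V v (v - w) d - V w d e
        \<le> (norm v)\<^sup>2 + a * (norm (v - (w + \<theta> *\<^sub>R d - b *\<^sub>R e)))\<^sup>2
          - (norm (w + \<theta> *\<^sub>R d - b *\<^sub>R e))\<^sup>2"
    using inertial_lyapunov_coercive[of \<theta> b a] theta b0 n0 unfolding n_def a_def by auto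
  have x_init: "x (-1) \<in> C" "x 0 \<in> C" "x 1 \<in> C"
    and y_eq: "\<And>k. k \<ge> 1 \<Longrightarrow> y k = x (int k) + \<theta> *\<^sub>R (x (int k) - x (int k - 1))
                + \<beta> *\<^sub>R (x (int k - 1) - x (int k - 2))"
    and z_min: "\<And>k. k \<ge> 1 \<Longrightarrow>
       is_arg_min (\<lambda>u. f (y k) u + 1 / (2 * lam k) * (norm (y k - u))\<^sup>2) (\<lambda>u. u \<in> C) (z k)"
    and x_eq: "\<And>k. k \<ge> 1 \<Longrightarrow> x (int k + 1) = (1 - \<rho>s k) *\<^sub>R y k + \<rho>s k *\<^sub>R z k"
    using run by (auto simp: RTIPPA_EP_def)
  have zC: "z k \<in> C" if "k \<ge> 1" for k
    using z_min[OF that] by (simp add: is_arg_min_def)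
  \<comment> \<open>The coefficients sum to 1 but may be negative, so convexity of \<open>C\<close>
    would not keep the extrapolated point inside; affinity does.\<close>
  have yC: "y k \<in> C" if "k \<ge> 1" "x (int k) \<in> C" "x (int k - 1) \<in> C" "x (int k - 2) \<in> C" for k
  proof -
    have "y k = (1 + \<theta>) *\<^sub>R x (int k) + (\<beta> - \<theta>) *\<^sub>R x (int k - 1) + (- \<beta>) *\<^sub>R x (int k - 2)"
      using y_eq[OF that(1)] by (simp add: algebra_simps)
    then show ?thesis using mem_affine_3[OF C(1) that(2-4), of "1 + \<theta>" "\<beta> - \<theta>" "- \<beta>"] by simp
  qed
  have xC: "x (int k) \<in> C \<and> x (int k + 1) \<in> C \<and> x (int k - 1) \<in> C" for k
  proof (induction k)
    case 0
    then show ?case using x_init by simp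
  next
    case (Suc k)
    have "y (Suc k) \<in> C" using Suc by (intro yC) (auto simp: add.commute)
    then have "x (int (Suc k) + 1) \<in> C"
      using x_eq[of "Suc k"] mem_affine[OF C(1) _ zC[of "Suc k"], of "y (Suc k)" "1 - \<rho>s (Suc k)" "\<rho>s (Suc k)"]
      by simp
    then show ?case using Suc by (simp add: add.commute)
  qed
  have yC': "y k \<in> C" if "k \<ge> 1" for k
    using that xC[of k] xC[of "k - 1"] by (intro yC) (auto simp: of_nat_diff)
  obtain p where p: "p \<in> EP_solutions C f" using sol by blast
  define l0 where "l0 = 1 / (\<gamma> - 8 * \<eta>)"
  have l0: "0 < l0" using gamma_eta by (simp add: l0_def)
  \<comment> \<open>A lower bound of \<open>2 * \<rho>s k * lam k * \<eta>\<close> uniform in k; it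
    serves both as decay rate and as margin for \<open>r * (2 - r - a * r)\<close>.\<close>
  define c where "c = 2 * (1 - \<rho>) * (l0 * \<eta>)"
  have c0: "0 < c" using rho l0 A5(1) by (simp add: c_def)
  \<comment> \<open>Index n stands for iteration k = n + 1, whose output is
    \<open>x (n + 2)\<close>; hence the offset 2 at the end.\<close>
  define v where "v n = x (int (Suc n) + 1) - p" for n
  define Y where "Y n = y (Suc n) - p" for n
  define Z where "Z n = z (Suc n) - p" for n
  define U where "U n = V (x (int (Suc n)) - p) (x (int (Suc n)) - x (int (Suc n) - 1))
      (x (int (Suc n) - 1) - x (int (Suc n) - 2))" for n
  have Y_eq: "Y n = (x (int (Suc n)) - p) + \<theta> *\<^sub>R (x (int (Suc n)) - x (int (Suc n) - 1))
      - b *\<^sub>R (x (int (Suc n) - 1) - x (int (Suc n) - 2))" for n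
    using y_eq[of "Suc n"] by (simp add: Y_def b_def)
  have "v \<longlonglongrightarrow> 0"
  proof (rule relaxed_steps_vanish[where a = a and c = c and Y = Y and Z = Z and U = U
        and r = "\<lambda>n. \<rho>s (Suc n)"])
    fix n
    let ?k = "Suc n"
    let ?r = "\<rho>s ?k" and ?l = "lam ?k"
    have k: "?k \<ge> 1" by simp
    show r0: "0 < ?r" using rhos_pos k by blast
    show r2: "?r \<le> 2" using C2[OF k] rho by linarith
    have l: "l0 < ?l" using C1[OF k] by (simp add: l0_def)
    have "(1 - \<rho>) * (l0 * \<eta>) \<le> ?r * (?l * \<eta>)"
      using C2[OF k] l A5(1) l0 r0 by (intro mult_mono) auto
    then have cr: "c \<le> 2 * ?r * ?l * \<eta>" unfolding c_def by linarith
    show v: "v n = (1 - ?r) *\<^sub>R Y n + ?r *\<^sub>R Z n"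
      unfolding v_def Y_def Z_def x_eq[OF k] by (simp add: algebra_simps)
    show "(norm (Y n))\<^sup>2 \<le> (1 + a) * U n" unfolding Y_eq U_def by (rule V0)
    show "U (Suc n) - U n \<le> (norm (v n))\<^sup>2 + a * (norm (v n - Y n))\<^sup>2 - (norm (Y n))\<^sup>2"
      unfolding Y_eq U_def
      using V1[of "v n" "x (int ?k) - p" "x (int ?k) - x (int ?k - 1)" "x (int ?k - 1) - x (int ?k - 2)"]
      by (simp add: v_def add.commute)
    have prox: "(y ?k - z ?k) \<bullet> (p - z ?k)
        \<le> 2 * ?l * \<eta> * (norm (y ?k - z ?k))\<^sup>2 - ?l * \<eta> * (norm (p - z ?k))\<^sup>2"
      using C1[OF k]
      by (intro prox_step_inequality[OF f_diag A2 A4(2) A5(2) A5(1) gamma_eta _ p yC'[OF k] z_min[OF k]]) auto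
    have vY: "v n - Y n = x (int ?k + 1) - y ?k" by (simp add: v_def Y_def)
    have st: "(norm (v n))\<^sup>2 + alpha_min \<eta> ?l ?r * (norm (v n - Y n))\<^sup>2
        + 2 * ?r * ?l * \<eta> * (norm (Z n))\<^sup>2 \<le> (norm (Y n))\<^sup>2"
      using relaxed_step_inequality[OF prox r0 x_eq[OF k]]
      unfolding vY unfolding v_def Y_def Z_def norm_minus_commute[of p] .
    have "a * (norm (v n - Y n))\<^sup>2 \<le> alpha_min \<eta> ?l ?r * (norm (v n - Y n))\<^sup>2"
      using bounds[OF k] by (intro mult_right_mono) auto
    moreover have "c * (norm (Z n))\<^sup>2 \<le> 2 * ?r * ?l * \<eta> * (norm (Z n))\<^sup>2"
      using cr by (intro mult_right_mono) auto
    ultimately show "(norm (v n))\<^sup>2 + a * (norm (v n - Y n))\<^sup>2 - (norm (Y n))\<^sup>2 \<le> - c * (norm (Z n))\<^sup>2"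
      using st by linarith
    have "a * ?r \<le> alpha_min \<eta> ?l ?r * ?r" using bounds[OF k] r0 by (intro mult_right_mono) auto
    also have "\<dots> = 2 - 4 * \<eta> * ?l - ?r" using r0 by (simp add: alpha_min_def)
    finally have "?r * (4 * \<eta> * ?l) \<le> ?r * (2 - ?r - a * ?r)"
      using r0 by (intro mult_left_mono) auto
    moreover have "0 \<le> 2 * ?r * ?l * \<eta>" using cr c0 by linarith
    then have "2 * ?r * ?l * \<eta> \<le> ?r * (4 * \<eta> * ?l)" by (simp add: ac_simps)
    ultimately show "c \<le> ?r * (2 - ?r - a * ?r)" using cr by linarith
  qed (use a0 c0 in auto)
  moreover have "v = (\<lambda>n. x (int (n + 2)) - p)"
  proof
    fix n
    have "int (Suc n) + 1 = int (n + 2)" by simp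
    then show "v n = x (int (n + 2)) - p" unfolding v_def by (simp only:)
  qed
  ultimately have "(\<lambda>n. x (int (n + 2)) - p) \<longlonglongrightarrow> 0" by simp
  then have "(\<lambda>n. x (int (n + 2))) \<longlonglongrightarrow> p" by (rule LIM_zero_cancel)
  then have "(\<lambda>k. x (int k)) \<longlonglongrightarrow> p" by (rule LIMSEQ_offset)
  then show ?thesis using p by blast
qed

end
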